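(* Let $P$ be a pseudo-polygon and assign to every invisible pair of $P$ its designated blocker. If $p_k\in\partial(p_i,p_j)$ is the blocker assigned to the invisible pair $(p_i,p_j)$, then both of the following are satisfied: (1) $p_k$ is the blocker assigned to the invisible pair $(p_i,p_t)$ for every $p_t\in\partial(p_{k+1},p_j)$; and (2) if $(p_k,p_j)$ is an invisible pair, then $p_i$ is not the blocker assigned to it.
   Context: **Pseudo-polygons.** An arrangement of pseudo-lines is a collection of simple curves in $\mathbb{R}^2$, each of which separates the plane, such that each pair of them intersects at exactly one point, where they cross. Let $P=\{p_0,\dots,p_{n-1}\}$ ($n\ge 3$) be a set of points in $\mathbb{R}^2$ and $\mathcal{L}$ an arrangement of $\binom n2$ pseudo-lines such that every pair of points $p_i,p_j$ lies on exactly one pseudo-line of $\mathcal{L}$, denoted $L_{i,j}$, and every pseudo-line in $\mathcal{L}$ contains exactly two points of $P$; $(P,\mathcal{L})$ is a pseudo configuration of points in general position. The subsegment of $L_{i,j}$ connecting $p_i$ and $p_j$ is the segment $p_ip_j$; removing it leaves two rays, one starting at $p_i$ and moving away from $p_j$, the other starting at $p_j$ and moving away from $p_i$. Indices are modulo $n$. Let $e_i$ be the segment $p_ip_{i+1}$. The segments $e_0,\dots,e_{n-1}$ form a pseudo-polygon (with boundary edges $e_i$) if $e_i\cap e_{i+1}=\{p_{i+1}\}$ for all $i$ and non-consecutive $e_i,e_j$ are disjoint. Vertices are indexed in counterclockwise order along the boundary. The pseudo-polygon separates the plane into an inside and an outside; two vertices $p_i,p_j$ see each other if the segment $p_ip_j$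 does not go outside the pseudo-polygon. **Combinatorial notions.** $\partial(p_i,p_j)$ denotes the vertices and boundary edges encountered when walking counterclockwise along the boundary from $p_i$ to $p_j$ (inclusive). Two vertices that see each other form a visible pair $\{p_i,p_j\}$ (unordered). If distinct $p_i,p_j$ do not see each other, both ordered pairs $(p_i,p_j)$ and $(p_j,p_i)$ are called invisible pairs. **Designated blocker.** Let $(p_i,p_j)$ be an invisible pair. A vertex $p_k\in\partial(p_i,p_j)$ is a designated blocker for $(p_i,p_j)$ if $p_i$ sees $p_k$ and the ray of $L_{i,k}$ starting at $p_k$ and moving away from $p_i$ first exits the pseudo-polygon through a boundary edge in $\partial(p_j,p_i)$. Similarly, $p_k\in\partial(p_j,p_i)$ is a designated blocker for $(p_i,p_j)$ if $p_i$ sees $p_k$ and the ray of $L_{i,k}$ starting at $p_k$ and moving away from $p_i$ first exits the pseudo-polygon through a boundary edge in $\partial(p_i,p_j)$. (Here $k\neq i,j$.) Every invisible pair in a pseudo-polygon has exactly one designated blocker, so the assignment is well defined. *)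

theory Defs
  imports "HOL-Complex_Analysis.Winding_Numbers"
begin

text \<open>The plane is the type of complex numbers.\<close>

subsection \<open>Pseudo-lines\<close>

text \<open>A pseudo-line is an unbounded curve without self-intersections, i.e. a properly embedded
  copy of the real line. Closedness of \<open>l\<close> rules out curves with an end converging to a point or
  to a bounded set. (Separation of the plane then follows from the Jordan curve theorem.)\<close>

definition pseudo_line :: "complex set \<Rightarrow> bool" where
  "pseudo_line l \<longleftrightarrow>
     closed l \<and> l homeomorphic (UNIV :: real set) \<and> \<not> connected (- l)"

text \<open>If \<open>m\<close> meets \<open>l\<close> only in \<open>x\<close>, then \<open>m\<close> without \<open>x\<close> consists of two half-lines, each on a
  single side of \<open>l\<close>; the curves cross at \<open>x\<close> iff these sides differ.\<close>

definition crosses_once :: "complex set \<Rightarrow> complex set \<Rightarrow> bool" where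
  "crosses_once l m \<longleftrightarrow>
     (\<exists>x. l \<inter> m = {x}) \<and>
     (\<exists>A \<in> components (- l). \<exists>B \<in> components (- l).
        A \<noteq> B \<and> m \<inter> A \<noteq> {} \<and> m \<inter> B \<noteq> {})"

definition pseudo_line_arrangement :: "complex set set \<Rightarrow> bool" where
  "pseudo_line_arrangement \<L> \<longleftrightarrow>
     (\<forall>l \<in> \<L>. pseudo_line l) \<and>
     (\<forall>l \<in> \<L>. \<forall>m \<in> \<L>. l \<noteq> m \<longrightarrow> crosses_once l m)"

text \<open>The unique arc within the pseudo-line \<open>l\<close> that joins two distinct points \<open>a\<close>, \<open>b\<close> of \<open>l\<close>.\<close>

definition subsegment :: "complex set \<Rightarrow> complex \<Rightarrow> complex \<Rightarrow> complex set" where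
  "subsegment l a b =
     (THE S. \<exists>g. arc g \<and> pathstart g = a \<and> pathfinish g = b \<and> path_image g = S \<and> S \<subseteq> l)"

text \<open>The ray of \<open>l\<close> starting at \<open>a\<close> and moving away from \<open>b\<close>. Its starting point is included.\<close>

definition subray :: "complex set \<Rightarrow> complex \<Rightarrow> complex \<Rightarrow> complex set" where
  "subray l a b =
     insert a (THE C. C \<in> components (l - subsegment l a b) \<and> a \<in> closure C)"

text \<open>A traveller on the ray \<open>R\<close>, starting at its end point \<open>a\<close>, stays in \<open>Q\<close> up to a point of
  \<open>e\<close> and leaves \<open>Q\<close> there. The exit point may be \<open>a\<close> itself.\<close>

definition first_exits_through ::
    "complex set \<Rightarrow> complex \<Rightarrow> complex set \<Rightarrow> complex set \<Rightarrow> bool" where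
  "first_exits_through R a Q e \<longleftrightarrow>
     (\<exists>g t. continuous_on {0..} g \<and> inj_on g {0..} \<and> g ` {0..} = R \<and> g 0 = a \<and>
        0 \<le> (t :: real) \<and> g ` {0..t} \<subseteq> Q \<and> (\<forall>s>t. \<exists>u \<in> {t<..<s}. g u \<notin> Q) \<and>
        g t \<in> e)"


subsection \<open>Pseudo configurations of points and pseudo-polygons\<close>

text \<open>The points are \<open>p 0, \<dots>, p (n - 1)\<close>; only the values of \<open>p\<close> below \<open>n\<close> matter.\<close>

definition pseudo_configuration ::
    "nat \<Rightarrow> (nat \<Rightarrow> complex) \<Rightarrow> complex set set \<Rightarrow> bool" where
  "pseudo_configuration n p \<L> \<longleftrightarrow>
     n \<ge> 3 \<and> inj_on p {..<n} \<and>
     pseudo_line_arrangement \<L> \<and> finite \<L> \<and> card \<L> = n choose 2 \<and>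
     (\<forall>i<n. \<forall>j<n. i \<noteq> j \<longrightarrow> (\<exists>!l. l \<in> \<L> \<and> p i \<in> l \<and> p j \<in> l)) \<and>
     (\<forall>l \<in> \<L>. card (l \<inter> p ` {..<n}) = 2)"

definition line :: "(nat \<Rightarrow> complex) \<Rightarrow> complex set set \<Rightarrow> nat \<Rightarrow> nat \<Rightarrow> complex set" where
  "line p \<L> i j = (THE l. l \<in> \<L> \<and> p i \<in> l \<and> p j \<in> l)"

definition segment :: "(nat \<Rightarrow> complex) \<Rightarrow> complex set set \<Rightarrow> nat \<Rightarrow> nat \<Rightarrow> complex set" where
  "segment p \<L> i j = subsegment (line p \<L> i j) (p i) (p j)"

text \<open>The ray starting at \<open>p i\<close> and moving away from \<open>p j\<close>.\<close>

definition ray :: "(nat \<Rightarrow> complex) \<Rightarrow> complex set set \<Rightarrow> nat \<Rightarrow> nat \<Rightarrow> complex set" where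
  "ray p \<L> i j = subray (line p \<L> i j) (p i) (p j)"

definition edge :: "nat \<Rightarrow> (nat \<Rightarrow> complex) \<Rightarrow> complex set set \<Rightarrow> nat \<Rightarrow> complex set" where
  "edge n p \<L> i = segment p \<L> i (Suc i mod n)"

definition boundary :: "nat \<Rightarrow> (nat \<Rightarrow> complex) \<Rightarrow> complex set set \<Rightarrow> complex set" where
  "boundary n p \<L> = (\<Union>i<n. edge n p \<L> i)"

text \<open>The vertices are indexed counterclockwise: some closed walk traversing the edges in the
  order of their indices winds once in the positive sense around every inside point.\<close>

definition counterclockwise :: "nat \<Rightarrow> (nat \<Rightarrow> complex) \<Rightarrow> complex set set \<Rightarrow> bool" where
  "counterclockwise n p \<L> \<longleftrightarrow>
     (\<exists>g. simple_path g \<and> pathfinish g = pathstart g \<and>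
        (\<forall>i<n. g (real i / real n) = p i \<and>
               g ` {real i / real n .. real (Suc i) / real n} = edge n p \<L> i) \<and>
        (\<forall>z \<in> inside (boundary n p \<L>). winding_number g z = 1))"

definition pseudo_polygon :: "nat \<Rightarrow> (nat \<Rightarrow> complex) \<Rightarrow> complex set set \<Rightarrow> bool" where
  "pseudo_polygon n p \<L> \<longleftrightarrow>
     pseudo_configuration n p \<L> \<and>
     (\<forall>i<n. edge n p \<L> i \<inter> edge n p \<L> (Suc i mod n) = {p (Suc i mod n)}) \<and>
     (\<forall>i<n. \<forall>j<n. i \<noteq> j \<and> j \<noteq> Suc i mod n \<and> i \<noteq> Suc j mod n \<longrightarrow>
        edge n p \<L> i \<inter> edge n p \<L> j = {}) \<and>
     counterclockwise n p \<L>"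


subsection \<open>Visibility and designated blockers\<close>

text \<open>Vertices and edges are referred to by their indices below \<open>n\<close>; edge \<open>m\<close> joins vertex \<open>m\<close>
  to its successor. For \<open>i, j < n\<close>, the next two sets are the vertices and the edges of the
  counterclockwise boundary walk from \<open>p i\<close> to \<open>p j\<close>, which has \<open>(j + n - i) mod n\<close> edges.\<close>

definition walk_vertices :: "nat \<Rightarrow> nat \<Rightarrow> nat \<Rightarrow> nat set" where
  "walk_vertices n i j = {(i + m) mod n | m. m \<le> (j + n - i) mod n}"

definition walk_edges :: "nat \<Rightarrow> nat \<Rightarrow> nat \<Rightarrow> nat set" where
  "walk_edges n i j = {(i + m) mod n | m. m < (j + n - i) mod n}"

definition sees :: "nat \<Rightarrow> (nat \<Rightarrow> complex) \<Rightarrow> complex set set \<Rightarrow> nat \<Rightarrow> nat \<Rightarrow> bool" where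
  "sees n p \<L> i j \<longleftrightarrow> segment p \<L> i j \<inter> outside (boundary n p \<L>) = {}"

definition invisible_pair ::
    "nat \<Rightarrow> (nat \<Rightarrow> complex) \<Rightarrow> complex set set \<Rightarrow> nat \<Rightarrow> nat \<Rightarrow> bool" where
  "invisible_pair n p \<L> i j \<longleftrightarrow> i < n \<and> j < n \<and> i \<noteq> j \<and> \<not> sees n p \<L> i j"

text \<open>\<open>p k\<close> is a designated blocker for the invisible pair \<open>(p i, p j)\<close>. A ray that goes outside
  immediately at \<open>p k\<close> has exit point \<open>p k\<close>, which lies on none of the edges allowed here.\<close>

definition designated_blocker ::
    "nat \<Rightarrow> (nat \<Rightarrow> complex) \<Rightarrow> complex set set \<Rightarrow> nat \<Rightarrow> nat \<Rightarrow> nat \<Rightarrow> bool" where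
  "designated_blocker n p \<L> i j k \<longleftrightarrow>
     invisible_pair n p \<L> i j \<and> k < n \<and> k \<noteq> i \<and> k \<noteq> j \<and> sees n p \<L> i k \<and>
     (k \<in> walk_vertices n i j \<and>
        (\<exists>m \<in> walk_edges n j i. first_exits_through
           (ray p \<L> k i) (p k) (- outside (boundary n p \<L>)) (edge n p \<L> m)) \<or>
      k \<in> walk_vertices n j i \<and>
        (\<exists>m \<in> walk_edges n i j. first_exits_through
           (ray p \<L> k i) (p k) (- outside (boundary n p \<L>)) (edge n p \<L> m)))"

end

theory Submission
  imports Defs
begin

text \<open>Two tools drive everything. First, where a pseudo-line crosses an edge of the polygon in
  the interior of that edge, it passes from the inside to the outside; this follows from
  Janiszewski's theorem, applied to the boundary curve \<open>J\<close> and to \<open>J \<union> L\<close> without the open edge,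
  where \<open>L\<close> is the line of the edge: they intersect in the connected set \<open>J\<close> without the open edge.
  Hence a segment between visible vertices is an edge or a chord (its relative interior is inside),
  and the ray behind a blocker, up to its exit point, is a chord as well. Second, two chords whose
  end points interlace on the boundary meet.

  If \<open>p k\<close> blocks \<open>(p i, p j)\<close> and the ray behind \<open>p k\<close> exits at \<open>x\<close>, the chord from \<open>p k\<close> to \<open>x\<close>
  separates \<open>p i\<close> from every vertex between \<open>p k\<close> and \<open>p j\<close>. As two lines through \<open>p i\<close> meet nowhere
  else, \<open>p i\<close> sees none of these vertices, and \<open>p k\<close> blocks all of them. A second blocker \<open>p k'\<close> of
  the same pair would either be such a vertex, or its segment or exit chord would interlace with
  that of \<open>p k\<close>. If \<open>p i\<close> were to block \<open>(p k, p j)\<close>, the exit chords of the two opposite rays on one line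
  would interlace.\<close>

subsection \<open>Cyclic order and chords of closed curves\<close>

text \<open>Strict cyclic order, obtained from a linear order by wrapping around. The type is
  general because both vertex indices and real boundary parameters are compared in this way.\<close>

definition cyc :: "'a::linorder \<Rightarrow> 'a \<Rightarrow> 'a \<Rightarrow> bool" where
  "cyc a b c \<longleftrightarrow> a < b \<and> b < c \<or> b < c \<and> c < a \<or> c < a \<and> a < b"

lemma cyc_of_nat [simp]:
  "cyc (real a) (real b) (real c) \<longleftrightarrow> cyc a b c"
  by (simp add: cyc_def)

lemma cyc_divide [simp]:
  fixes a b c d :: real
  assumes "0 < d"
  shows "cyc (a / d) (b / d) (c / d) \<longleftrightarrow> cyc a b c"
  using assms by (simp add: cyc_def divide_less_cancel)

lemma cyc_rotate: "cyc a b c \<Longrightarrow> cyc b c a"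
  by (auto simp: cyc_def)

lemma cyc_trans:
  assumes "cyc a b c" "cyc a c d"
  shows "cyc a b d" "cyc b c d"
  using assms by (auto simp: cyc_def)

lemma cyc_between:
  assumes "cyc a b c" "cyc c d a"
  shows "cyc b d a" "cyc b c d"
  using cyc_trans[OF assms(1) cyc_rotate[OF cyc_rotate[OF assms(2)]]] cyc_rotate by blast+

lemma cyc_total:
  assumes "a \<noteq> b" "a \<noteq> c" "b \<noteq> c"
  shows "cyc a b c \<or> cyc a c b"
  using assms by (auto simp: cyc_def not_less_iff_gr_or_eq)

lemma cyc_distinct:
  assumes "cyc a b c"
  shows "a \<noteq> b" "a \<noteq> c" "b \<noteq> c"
  using assms by (auto simp: cyc_def)

text \<open>Meant for two blockers \<open>k\<close>, \<open>k'\<close> of one pair on different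
  sides, with \<open>s\<close>, \<open>s'\<close> the exits of the rays behind them. Unless an exit
  lies so close to \<open>i\<close> that its chord hides the other blocker, the cyclic order is
  \<open>k\<close>, \<open>s'\<close>, \<open>s\<close>, \<open>k'\<close>, so that the two exit
  chords interlace.\<close>

lemma cyc_two_chords:
  fixes i k j k' s s' :: "'a::linorder"
  assumes "cyc i k j" "cyc j k' i" "cyc j s i" "cyc i s' j" "s \<noteq> k'" "s' \<noteq> k"
  shows "cyc k' s i \<or> cyc i s' k \<or> cyc k s' s \<and> cyc s k' k"
proof -
  have "cyc k' s i \<or> cyc j s k'"
    using assms(2,3,5) by (auto simp: cyc_def)
  moreover have "cyc i s' k \<or> cyc k s' j"
    using assms(1,4,6) by (auto simp: cyc_def)
  moreover have "cyc k s' s" if "cyc k s' j"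
    using cyc_trans(1)[OF that cyc_between(2)[OF assms(1,3)]] .
  moreover have "cyc j k' k"
    using cyc_rotate[OF cyc_between(2)[OF assms(1,2)]] .
  then have "cyc s k' k" if "cyc j s k'"
    using cyc_trans(2)[OF that] by blast
  ultimately show ?thesis by blast
qed

section \<open>Cross-cuts of a closed curve and their intersections\<close>

text \<open>A cross-cut of the region bounded by \<open>g\<close>. Its ends are given as parameters
  of \<open>g\<close>, so that interlacing can be expressed by \<open>cyc\<close>.\<close>

definition chord :: "(real \<Rightarrow> complex) \<Rightarrow> real \<Rightarrow> real \<Rightarrow> complex set \<Rightarrow> bool" where
  "chord g a b C \<longleftrightarrow>
     (\<exists>c. arc c \<and> pathstart c = g a \<and> pathfinish c = g b \<and> path_image c = C \<and>
        C - {g a, g b} \<subseteq> inside (path_image g))"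

lemma chord_commute: "chord g a b C \<longleftrightarrow> chord g b a C"
proof -
  have "chord g b a C" if "chord g a b C" for a b
    using that unfolding chord_def
    by (metis arc_reversepath insert_commute path_image_reversepath pathfinish_reversepath
        pathstart_reversepath)
  then show ?thesis by blast
qed

lemma simple_path_inj_half_open:
  assumes "simple_path g" "0 \<le> s" "s < 1" "0 \<le> t" "t < 1" "g s = g t"
  shows "s = t"
  using assms by (fastforce simp: simple_path_def loop_free_def)

lemma simple_path_inj_interior:
  assumes "simple_path g" "0 < s" "s < 1" "0 \<le> t" "t \<le> 1" "g s = g t"
  shows "s = t"
  using assms by (fastforce simp: simple_path_def loop_free_def)

text \<open>\<open>C\<close> and the two arcs of \<open>g\<close> between its ends form a theta
  curve, which splits the inside into two regions. If \<open>C'\<close> missed \<open>C\<close>, its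
  relative interior would lie in one region and its ends in the closure of that region; but
  \<open>g u\<close> and \<open>g w\<close> lie on different arcs.\<close>

lemma chords_from_start_meet:
  fixes g :: "real \<Rightarrow> complex"
  assumes g: "simple_path g" "pathfinish g = pathstart g"
    and uvw: "0 < u" "u < v" "v < w" "w < 1"
    and C: "chord g 0 v C" and C': "chord g u w C'"
  shows "C \<inter> C' \<noteq> {}"
proof
  assume disj: "C \<inter> C' = {}"
  let ?J = "path_image g"
  obtain c where c: "arc c" "pathstart c = g 0" "pathfinish c = g v" "path_image c = C"
    and cin: "C - {g 0, g v} \<subseteq> inside ?J"
    using C unfolding chord_def by blast
  obtain c' where c': "arc c'" "pathstart c' = g u" "pathfinish c' = g w" "path_image c' = C'"
    and c'in: "C' - {g u, g w} \<subseteq> inside ?J"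
    using C' unfolding chord_def by blast
  have inj: "s = t" if "0 \<le> s" "s < 1" "0 \<le> t" "t < 1" "g s = g t" for s t
    using simple_path_inj_half_open[OF g(1) that] .
  have g1: "g 1 = g 0"
    using g(2) by (simp add: pathstart_def pathfinish_def)
  define c1 where "c1 = subpath 0 v g"
  \<comment> \<open>Run backwards from \<open>g 1 = g 0\<close>, so that \<open>c1\<close>,
    \<open>c2\<close> and \<open>c\<close> share both start and finish.\<close>
  define c2 where "c2 = subpath 1 v g"
  have im1: "path_image c1 = g ` {0..v}" and im2: "path_image c2 = g ` {v..1}"
    using uvw by (simp_all add: c1_def c2_def path_image_subpath)
  have J: "path_image c1 \<union> path_image c2 = ?J"
    using uvw unfolding im1 im2 image_Un[symmetric]
    by (simp add: path_image_def ivl_disj_un_two_touch)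
  have s1: "simple_path c1" and s2: "simple_path c2"
    unfolding c1_def c2_def
    using uvw by (auto intro!: arc_imp_simple_path arc_simple_path_subpath_interior g)
  have ends: "pathstart c1 = g 0" "pathfinish c1 = g v" "pathstart c2 = g 0" "pathfinish c2 = g v"
    by (simp_all add: c1_def c2_def g1)
  have CJ: "C \<inter> ?J = {g 0, g v}"
  proof -
    have "inside ?J \<inter> ?J = {}" by (rule inside_no_overlap)
    moreover have "g 0 \<in> ?J" "g v \<in> ?J" using uvw by (auto simp: path_image_def)
    moreover have "g 0 \<in> C" "g v \<in> C"
      using c by (metis pathstart_in_path_image, metis pathfinish_in_path_image)
    ultimately show ?thesis using cin by blast
  qed
  have v0: "g 0 \<noteq> g v" using inj[of 0 v] uvw by auto
  have i12: "path_image c1 \<inter> path_image c2 = {g 0, g v}"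
  proof -
    have "x \<in> {g 0, g v}" if x: "x \<in> g ` {0..v}" "x \<in> g ` {v..1}" for x
    proof -
      obtain s t where st: "x = g s" "0 \<le> s" "s \<le> v" "x = g t" "v \<le> t" "t \<le> 1"
        using x by (elim imageE) auto
      show ?thesis
      proof (cases "t = 1")
        case False
        then have "s = t" using st uvw by (intro inj) auto
        then show ?thesis using st by auto
      qed (use st g1 in auto)
    qed
    moreover have "g 0 \<in> g ` {0..v}" "g v \<in> g ` {0..v}" "g v \<in> g ` {v..1}" "g 1 \<in> g ` {v..1}"
      using uvw by auto
    ultimately show ?thesis unfolding im1 im2 g1 by blast
  qed
  have ends_in: "{g 0, g v} \<subseteq> path_image c1" "{g 0, g v} \<subseteq> path_image c2"
    using i12 by auto
  have i1: "path_image c1 \<inter> path_image c = {g 0, g v}"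
    and i2: "path_image c2 \<inter> path_image c = {g 0, g v}"
    using CJ ends_in J c(4) by auto
  have "C - {g 0, g v} \<noteq> {}"
    using nonempty_simple_path_endless[OF arc_imp_simple_path[OF c(1)]] c by simp
  then have ne: "path_image c \<inter> inside (path_image c1 \<union> path_image c2) \<noteq> {}"
    using cin unfolding J c(4) by blast
  obtain I: "inside (path_image c1 \<union> C) \<inter> inside (path_image c2 \<union> C) = {}"
    "inside (path_image c1 \<union> C) \<union> inside (path_image c2 \<union> C) \<union> (C - {g 0, g v}) = inside ?J"
    using split_inside_simple_closed_curve[OF s1 ends(1,2) s2 ends(3,4)
        arc_imp_simple_path[OF c(1)] c(2,3) v0 i12 i1 i2 ne] unfolding J c(4) by blast
  define E where "E = C' - {g u, g w}"
  have conE: "connected E"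
    using connected_simple_path_endless[OF arc_imp_simple_path[OF c'(1)]] c' by (simp add: E_def)
  have cl: "closed (path_image c1 \<union> C)" "closed (path_image c2 \<union> C)"
    using closed_path_image[OF simple_path_imp_path[OF s1]]
      closed_path_image[OF simple_path_imp_path[OF s2]] closed_path_image[OF arc_imp_path[OF c(1)]]
    unfolding c(4) by (simp_all add: closed_Un)
  have "E \<subseteq> inside (path_image c1 \<union> C) \<union> inside (path_image c2 \<union> C)"
    using I(2) c'in disj unfolding E_def by blast
  then have "E \<subseteq> inside (path_image c1 \<union> C) \<or> E \<subseteq> inside (path_image c2 \<union> C)"
    using connectedD[OF conE open_inside[OF cl(1)] open_inside[OF cl(2)]] I(1) by blast
  moreover have clE: "C' \<subseteq> closure E"
  proof -
    have "path_image c' = c' ` closure {0<..<1}"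
      by (simp add: path_image_def)
    also have "\<dots> \<subseteq> closure (c' ` {0<..<1})"
      by (rule image_closure_subset)
         (use arc_imp_path[OF c'(1)] in \<open>auto simp: path_def closure_subset\<close>)
    also have "c' ` {0<..<1} = E"
      using simple_path_endless[OF arc_imp_simple_path[OF c'(1)]] c' by (simp add: E_def)
    finally show ?thesis using c' by simp
  qed
  have uw: "g u \<in> C'" "g w \<in> C'"
    using c' by (metis pathstart_in_path_image, metis pathfinish_in_path_image)
  have nin: "g u \<notin> inside ?J" "g w \<notin> inside ?J"
  proof -
    have "g u \<in> ?J" "g w \<in> ?J" using uvw by (auto simp: path_image_def)
    then show "g u \<notin> inside ?J" "g w \<notin> inside ?J"
      using inside_no_overlap[of ?J] by blast+
  qed
  have "g w \<notin> path_image c1"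
    unfolding im1 using inj[of w] uvw by fastforce
  moreover have "g u \<notin> path_image c2"
  proof
    assume "g u \<in> path_image c2"
    then obtain t where t: "g u = g t" "v \<le> t" "t \<le> 1" unfolding im2 by auto
    show False
    proof (cases "t = 1")
      case True then show ?thesis using inj[of u 0] t g1 uvw by auto
    next
      case False then show ?thesis using inj[of u t] t uvw by auto
    qed
  qed
  \<comment> \<open>Applied to the arc \<open>c1\<close> with \<open>g w\<close> and to
    \<open>c2\<close> with \<open>g u\<close>: this end of \<open>C'\<close> would have to lie on
    the wrong arc, on \<open>C\<close>, or inside the curve, and all three are excluded.\<close>
  moreover have "x \<in> S \<union> C \<union> inside (S \<union> C)"
    if "E \<subseteq> inside (S \<union> C)" "closed (S \<union> C)" "x \<in> C'" for S x
    using closure_mono[OF that(1)] closure_inside_subset[OF that(2)] that(3) clE by blast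
  ultimately show False
    using cl uw nin disj I(2) by blast
qed

text \<open>\<open>shiftpath\<close> moves the base point to \<open>g a\<close>, and
  \<open>sh\<close> converts the parameters. The first chord then starts at 0 and the cyclic order
  of the ends becomes linear.\<close>

lemma interlaced_chords_meet:
  fixes g :: "real \<Rightarrow> complex"
  assumes g: "simple_path g" "pathfinish g = pathstart g"
    and pos: "{a, b, a', b'} \<subseteq> {0..<1}"
    and cyc: "cyc a a' b" "cyc b b' a"
    and C: "chord g a b C" and C': "chord g a' b' C'"
  shows "C \<inter> C' \<noteq> {}"
proof -
  define sh where "sh s = (if a \<le> s then s - a else s - a + 1)" for s
  have a: "0 \<le> a" "a < 1" using pos by auto
  have sh: "shiftpath a g (sh s) = g s" if "0 \<le> s" "s < 1" for s
    using g(2) that a by (auto simp: shiftpath_def sh_def pathstart_def pathfinish_def)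
  have im: "path_image (shiftpath a g) = path_image g"
    using path_image_shiftpath[of a g] g(2) a by auto
  have ch: "chord (shiftpath a g) (sh s) (sh t) D \<longleftrightarrow> chord g s t D"
    if "s \<in> {0..<1}" "t \<in> {0..<1}" for s t D
    using sh[of s] sh[of t] that unfolding chord_def im by auto
  show ?thesis
  proof (rule chords_from_start_meet)
    show "simple_path (shiftpath a g)"
      using simple_path_shiftpath[OF g] a by auto
    show "pathfinish (shiftpath a g) = pathstart (shiftpath a g)"
      using closed_shiftpath[OF g(2)] a by auto
    show "chord (shiftpath a g) 0 (sh b) C"
      using ch[of a b C] C pos by (simp add: sh_def)
    show "chord (shiftpath a g) (sh a') (sh b') C'"
      using ch[of a' b' C'] C' pos by simp
    show "0 < sh a'" "sh a' < sh b" "sh b < sh b'" "sh b' < 1"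
      using pos cyc by (auto simp: sh_def cyc_def)
  qed
qed

subsection \<open>Pseudo-lines\<close>

text \<open>With the inverse map hidden, order along a pseudo-line is just the order of
  parameters.\<close>

definition line_param :: "(real \<Rightarrow> complex) \<Rightarrow> complex set \<Rightarrow> bool" where
  "line_param f l \<longleftrightarrow> (\<exists>f'. homeomorphism UNIV l f f')"

lemma line_paramD:
  assumes "line_param f l"
  shows "continuous_on A f" "f s = f t \<longleftrightarrow> s = t" "range f = l" "f s \<in> l"
proof -
  obtain f' where h: "homeomorphism UNIV l f f'" using assms unfolding line_param_def by blast
  show "continuous_on A f" using homeomorphism_cont1[OF h] continuous_on_subset by blast
  show "f s = f t \<longleftrightarrow> s = t" using homeomorphism_apply1[OF h] by (metis UNIV_I)
  show "range f = l" using homeomorphism_image1[OF h] .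
  then show "f s \<in> l" by blast
qed

text \<open>Reversal puts two given points into the desired order and reduces rays to the left to
  rays to the right.\<close>

lemma line_param_uminus:
  assumes "line_param f l"
  shows "line_param (f \<circ> uminus) l"
proof -
  obtain f' where h: "homeomorphism UNIV l f f'" using assms unfolding line_param_def by blast
  have "homeomorphism (UNIV :: real set) UNIV uminus uminus"
    by (rule homeomorphismI) (auto intro!: continuous_intros)
  from homeomorphism_compose[OF this h] show ?thesis unfolding line_param_def by blast
qed

lemma line_param_through:
  assumes "pseudo_line l" "a \<in> l" "b \<in> l" "a \<noteq> b"
  obtains f \<alpha> \<beta> where "line_param f l" "\<alpha> < \<beta>" "f \<alpha> = a" "f \<beta> = b"
proof -
  have "(UNIV :: real set) homeomorphic l"
    using assms(1) homeomorphic_sym unfolding pseudo_line_def by blast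
  then obtain f f' where h: "homeomorphism (UNIV :: real set) l f f'"
    unfolding homeomorphic_def by blast
  have ab: "f (f' a) = a" "f (f' b) = b"
    using homeomorphism_apply2[OF h] assms by auto
  show ?thesis
  proof (cases "f' a < f' b")
    case True
    then show ?thesis using that[of f "f' a" "f' b"] h ab unfolding line_param_def by blast
  next
    case False
    moreover have "line_param f l" using h unfolding line_param_def by blast
    then have "line_param (f \<circ> uminus) l" by (rule line_param_uminus)
    moreover have "f' a \<noteq> f' b" using ab assms(4) by auto
    ultimately show ?thesis
      using that[of "f \<circ> uminus" "- f' a" "- f' b"] ab by auto
  qed
qed

lemma line_param_closed_image:
  assumes "line_param f l" "closed l" "closed S"
  shows "closed (f ` S)"
proof -
  obtain f' where h: "homeomorphism UNIV l f f'" using assms unfolding line_param_def by blast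
  have "f ` S = l \<inter> f' -` S"
    using homeomorphism_apply1[OF h] homeomorphism_apply2[OF h] homeomorphism_image1[OF h]
    by (auto simp: image_iff)
  then show ?thesis
    using continuous_closed_preimage[OF homeomorphism_cont2[OF h] assms(2,3)] by simp
qed

text \<open>Pulled back to the reals, \<open>g\<close> is continuous and injective, hence maps onto
  the segment between its end values. Thus an arc within \<open>l\<close> is determined by its
  ends.\<close>

lemma line_param_arc_image:
  fixes a b :: real
  assumes f: "line_param f l" and "a \<le> b"
    and g: "continuous_on {a..b} g" "inj_on g {a..b}" "g ` {a..b} \<subseteq> l"
    and ends: "g a = f \<alpha>" "g b = f \<beta>"
  shows "g ` {a..b} = f ` closed_segment \<alpha> \<beta>"
proof -
  obtain f' where h: "homeomorphism UNIV l f f'" using f unfolding line_param_def by blast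
  have cont: "continuous_on {a..b} (f' \<circ> g)"
    using continuous_on_compose[OF g(1)] continuous_on_subset[OF homeomorphism_cont2[OF h] g(3)]
    by blast
  have "inj_on f' l"
    using homeomorphism_apply2[OF h] by (metis inj_on_def)
  then have "inj_on (f' \<circ> g) {a..b}"
    using g(2,3) comp_inj_on inj_on_subset by blast
  then have "(f' \<circ> g) ` {a..b} = closed_segment (f' (g a)) (f' (g b))"
    using continuous_injective_image_segment_1[of a b "f' \<circ> g"] cont \<open>a \<le> b\<close>
    by (simp add: closed_segment_eq_real_ivl)
  moreover have "f ` (f' \<circ> g) ` {a..b} = g ` {a..b}"
    using homeomorphism_apply2[OF h] g(3) unfolding image_image
    by (auto simp: image_subset_iff intro!: image_cong)
  ultimately show ?thesis
    using ends homeomorphism_apply1[OF h] by simp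
qed

section \<open>Subsegments, rays and exits as parameter intervals\<close>

lemma subsegment_commute: "subsegment l a b = subsegment l b a"
proof -
  define arcs where
    "arcs a b S g \<longleftrightarrow> arc g \<and> pathstart g = a \<and> pathfinish g = b \<and> path_image g = S \<and> S \<subseteq> l"
    for a b S g
  have "arcs b a S (reversepath g)" if "arcs a b S g" for a b S g
    using that by (simp add: arcs_def arc_reversepath)
  then have "(\<exists>g. arcs a b S g) \<longleftrightarrow> (\<exists>g. arcs b a S g)" for S
    by blast
  then show ?thesis unfolding subsegment_def arcs_def by simp
qed

lemma arc_line_param:
  assumes f: "line_param f l" and "\<alpha> < \<beta>"
  shows "arc (f \<circ> linepath \<alpha> \<beta>)" "path_image (f \<circ> linepath \<alpha> \<beta>) = f ` {\<alpha>..\<beta>}"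
    "pathstart (f \<circ> linepath \<alpha> \<beta>) = f \<alpha>" "pathfinish (f \<circ> linepath \<alpha> \<beta>) = f \<beta>"
proof -
  show "arc (f \<circ> linepath \<alpha> \<beta>)"
    unfolding arc_def
  proof
    show "path (f \<circ> linepath \<alpha> \<beta>)"
      by (intro path_continuous_image path_linepath line_paramD(1)[OF f])
    show "inj_on (f \<circ> linepath \<alpha> \<beta>) {0..1}"
      using arc_linepath[of \<alpha> \<beta>] \<open>\<alpha> < \<beta>\<close> line_paramD(2)[OF f]
      unfolding arc_def inj_on_def by auto
  qed
  show "path_image (f \<circ> linepath \<alpha> \<beta>) = f ` {\<alpha>..\<beta>}"
    using \<open>\<alpha> < \<beta>\<close> by (simp add: path_image_compose closed_segment_eq_real_ivl)
qed (simp_all add: pathstart_compose pathfinish_compose)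

lemma subsegment_line_param:
  assumes f: "line_param f l" and "\<alpha> < \<beta>"
  shows "subsegment l (f \<alpha>) (f \<beta>) = f ` {\<alpha>..\<beta>}"
  unfolding subsegment_def
proof (rule the_equality)
  show "\<exists>g. arc g \<and> pathstart g = f \<alpha> \<and> pathfinish g = f \<beta> \<and> path_image g = f ` {\<alpha>..\<beta>} \<and>
      f ` {\<alpha>..\<beta>} \<subseteq> l"
    using arc_line_param[OF assms] line_paramD(4)[OF f] by blast
next
  fix S assume "\<exists>g. arc g \<and> pathstart g = f \<alpha> \<and> pathfinish g = f \<beta> \<and> path_image g = S \<and> S \<subseteq> l"
  then obtain g where g: "arc g" "pathstart g = f \<alpha>" "pathfinish g = f \<beta>" "path_image g = S" "S \<subseteq> l"
    by blast
  have "g ` {0..1} = f ` closed_segment \<alpha> \<beta>"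
    by (rule line_param_arc_image[OF f])
       (use g in \<open>auto simp: arc_def path_def path_image_def pathstart_def pathfinish_def\<close>)
  then show "S = f ` {\<alpha>..\<beta>}"
    using g(4) \<open>\<alpha> < \<beta>\<close> by (simp add: path_image_def closed_segment_eq_real_ivl)
qed

text \<open>Removing the segment leaves two half-lines. The one after \<beta> is a component, since
  a connected set meeting both would pull back to an interval containing \<beta>. Any other
  component lies in the image of \<open>{..\<alpha>}\<close>, which is closed because
  \<open>l\<close> is, and so does not have \<open>f \<beta>\<close> in its closure.\<close>

lemma subray_line_param:
  assumes f: "line_param f l" and l: "closed l" and "\<alpha> < \<beta>"
  shows "subray l (f \<beta>) (f \<alpha>) = f ` {\<beta>..}"
proof -
  have seg: "subsegment l (f \<beta>) (f \<alpha>) = f ` {\<alpha>..\<beta>}"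
    using subsegment_line_param[OF f \<open>\<alpha> < \<beta>\<close>] subsegment_commute by metis
  note fD = line_paramD[OF f]
  have rest: "l - f ` {\<alpha>..\<beta>} = f ` {..<\<alpha>} \<union> f ` {\<beta><..}"
  proof -
    have "inj f" using fD(2) by (simp add: inj_on_def)
    then have "l - f ` {\<alpha>..\<beta>} = f ` (UNIV - {\<alpha>..\<beta>})"
      using fD(3) by (simp add: image_set_diff)
    also have "UNIV - {\<alpha>..\<beta>} = {..<\<alpha>} \<union> {\<beta><..}"
      by auto
    finally show ?thesis by (simp add: image_Un)
  qed
  have comp: "f ` {\<beta><..} \<in> components (l - f ` {\<alpha>..\<beta>})"
    unfolding in_components_maximal
  proof (intro conjI allI impI)
    show "connected (f ` {\<beta><..})"
      by (intro connected_continuous_image fD(1)) simp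
    show "f ` {\<beta><..} \<subseteq> l - f ` {\<alpha>..\<beta>}" "f ` {\<beta><..} \<noteq> {}" using rest by auto
    fix D assume D: "D \<noteq> {} \<and> f ` {\<beta><..} \<subseteq> D \<and> D \<subseteq> l - f ` {\<alpha>..\<beta>} \<and> connected D"
    then have Dl: "D \<subseteq> l" by blast
    obtain f' where h: "homeomorphism UNIV l f f'" using f unfolding line_param_def by blast
    have D': "connected (f' ` D)"
      by (rule connected_continuous_image[OF continuous_on_subset[OF homeomorphism_cont2[OF h] Dl]])
         (use D in blast)
    have "f s \<in> f ` {\<beta><..}" if "f s \<in> D" for s
    proof (rule ccontr)
      assume "f s \<notin> f ` {\<beta><..}"
      moreover have "f s \<in> l - f ` {\<alpha>..\<beta>}" using that D by blast
      ultimately have "f s \<in> f ` {..<\<alpha>}" unfolding rest by simp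
      then have "s < \<alpha>" using fD(2) by auto
      moreover have "s \<in> f' ` D" using imageI[OF that, of f'] homeomorphism_apply1[OF h] by simp
      moreover have "f (\<beta> + 1) \<in> D" using D by (blast intro: less_add_one)
      then have "\<beta> + 1 \<in> f' ` D" using imageI[of "f (\<beta> + 1)" D f'] homeomorphism_apply1[OF h] by simp
      ultimately have "\<beta> \<in> f' ` D" using connectedD_interval[OF D', of s "\<beta> + 1" \<beta>] \<open>\<alpha> < \<beta>\<close> by simp
      then have "f \<beta> \<in> D" using Dl homeomorphism_apply2[OF h] by auto
      then show False using D \<open>\<alpha> < \<beta>\<close> by auto
    qed
    then show "D = f ` {\<beta><..}" using D unfolding fD(3)[symmetric] by blast
  qed
  have "(THE C. C \<in> components (l - f ` {\<alpha>..\<beta>}) \<and> f \<beta> \<in> closure C) = f ` {\<beta><..}"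
  proof (rule the_equality)
    have "f ` closure {\<beta><..} \<subseteq> closure (f ` {\<beta><..})"
      by (rule image_closure_subset[OF fD(1)]) (auto simp: closure_subset)
    then show "f ` {\<beta><..} \<in> components (l - f ` {\<alpha>..\<beta>}) \<and> f \<beta> \<in> closure (f ` {\<beta><..})"
      using comp by auto
  next
    fix C assume C: "C \<in> components (l - f ` {\<alpha>..\<beta>}) \<and> f \<beta> \<in> closure C"
    show "C = f ` {\<beta><..}"
    proof (rule ccontr)
      assume "C \<noteq> f ` {\<beta><..}"
      then have "C \<inter> f ` {\<beta><..} = {}" using C comp components_nonoverlap[of C] by blast
      moreover have "C \<subseteq> f ` {..<\<alpha>} \<union> f ` {\<beta><..}"
        using in_components_subset C unfolding rest by blast
      ultimately have "C \<subseteq> f ` {..<\<alpha>}" by blast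
      also have "f ` {..<\<alpha>} \<subseteq> f ` {..\<alpha>}" by (rule image_mono) auto
      finally have "C \<subseteq> f ` {..\<alpha>}" .
      then have "closure C \<subseteq> f ` {..\<alpha>}"
        by (intro closure_minimal line_param_closed_image[OF f l]) auto
      then have "f \<beta> \<in> f ` {..\<alpha>}" using C by blast
      then show False using fD(2) \<open>\<alpha> < \<beta>\<close> by auto
    qed
  qed
  moreover have "insert (f \<beta>) (f ` {\<beta><..}) = f ` {\<beta>..}"
    unfolding image_insert[symmetric] by (rule arg_cong[where f = "image f"]) auto
  ultimately show ?thesis unfolding subray_def seg by simp
qed

lemma subray_line_param_left:
  assumes f: "line_param f l" and l: "closed l" and "\<alpha> < \<beta>"
  shows "subray l (f \<alpha>) (f \<beta>) = f ` {..\<alpha>}"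
proof -
  have "subray l ((f \<circ> uminus) (- \<alpha>)) ((f \<circ> uminus) (- \<beta>)) = (f \<circ> uminus) ` {- \<alpha>..}"
    using subray_line_param[OF line_param_uminus[OF f] l, of "- \<beta>" "- \<alpha>"] \<open>\<alpha> < \<beta>\<close> by simp
  then show ?thesis unfolding image_comp[symmetric] by simp
qed

text \<open>The traveller may use another parametrization than \<open>f\<close>, but the part
  travelled up to the exit is an arc within \<open>l\<close>, so \<open>line_param_arc_image\<close>
  applies.\<close>

lemma first_exits_through_line_param:
  assumes f: "line_param f l"
    and ex: "first_exits_through (f ` {\<beta>..}) (f \<beta>) Q e"
  obtains \<xi> where "\<beta> \<le> \<xi>" "f ` {\<beta>..\<xi>} \<subseteq> Q" "f \<xi> \<in> e"
proof -
  obtain g t where g: "continuous_on {0..} g" "inj_on g {0..}" "g ` {0..} = f ` {\<beta>..}"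
      "g 0 = f \<beta>" and t: "0 \<le> (t::real)" "g ` {0..t} \<subseteq> Q" "g t \<in> e"
    using ex unfolding first_exits_through_def by blast
  have "g t \<in> f ` {\<beta>..}" using g(3) t(1) by auto
  then obtain \<xi> where \<xi>: "g t = f \<xi>" "\<beta> \<le> \<xi>" by auto
  have "g ` {0..t} = f ` closed_segment \<beta> \<xi>"
  proof (rule line_param_arc_image[OF f t(1)])
    show "continuous_on {0..t} g" using g(1) continuous_on_subset by fastforce
    show "inj_on g {0..t}" using g(2) inj_on_subset by fastforce
    have "g ` {0..t} \<subseteq> g ` {0..}" by auto
    then show "g ` {0..t} \<subseteq> l" using g(3) line_paramD(4)[OF f] by auto
  qed (use g \<xi> in auto)
  then show ?thesis
    using that[of \<xi>] t \<xi> by (simp add: closed_segment_eq_real_ivl)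
qed

text \<open>Here \<open>l'\<close> is the line of an edge and \<open>l\<close> crosses it inside
  that edge. If \<open>l\<close> avoided the outside near the crossing, points just before and just
  after it would both be inside. By Janiszewski's theorem they could then be joined off
  \<open>l'\<close>, so \<open>l\<close> would stay on one side of \<open>l'\<close>.\<close>

lemma crossing_edge_leaves_region:
  assumes g: "simple_path g" "pathfinish g = pathstart g"
    and f: "line_param f l" and h: "line_param h l'" and l': "closed l'"
    and cr: "crosses_once l' l"
    and z: "f \<zeta> = h \<eta>" "\<alpha> < \<eta>" "\<eta> < \<beta>"
    and ab: "0 \<le> a" "a < b" "b \<le> 1"
    and e: "g ` {a<..<b} = h ` {\<alpha><..<\<beta>}"
    and st: "\<sigma> < \<zeta>" "\<zeta> < \<tau>"
  shows "\<not> f ` {\<sigma>..\<tau>} \<subseteq> - outside (path_image g)"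
proof
  assume Q: "f ` {\<sigma>..\<tau>} \<subseteq> - outside (path_image g)"
  let ?J = "path_image g"
  note fD = line_paramD[OF f] and hD = line_paramD[OF h]
  \<comment> \<open>\<open>A\<close> is the boundary without the open edge, connected through
    \<open>g 0 = g 1\<close>. \<open>T\<close> adds the rest of \<open>l'\<close> without the open
    edge, so that the boundary and \<open>T\<close> meet exactly in \<open>A\<close>.\<close>
  define A where "A = g ` {0..a} \<union> g ` {b..1}"
  define T where "T = A \<union> h ` ({..\<alpha>} \<union> {\<beta>..})"
  have pg: "path g" using g by (simp add: simple_path_imp_path)
  have cg: "continuous_on B g" if "B \<subseteq> {0..1}" for B
    using pg that continuous_on_subset unfolding path_def by blast
  have split: "{0..1} = {0..a} \<union> {b..1} \<union> {a<..<b}" using ab by auto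
  have J: "?J = A \<union> g ` {a<..<b}"
    unfolding path_image_def A_def image_Un[symmetric] using split by simp
  have disjA: "A \<inter> g ` {a<..<b} = {}"
  proof -
    have "g s \<noteq> g t" if "s \<in> {0..a} \<union> {b..1}" "t \<in> {a<..<b}" for s t
      using simple_path_inj_interior[OF g(1), of t s] that ab by auto
    then show ?thesis unfolding A_def by blast
  qed
  have disjh: "h ` ({..\<alpha>} \<union> {\<beta>..}) \<inter> h ` {\<alpha><..<\<beta>} = {}"
    using hD(2) by auto
  have ST: "?J \<inter> T = A"
    using J disjh e unfolding T_def by blast
  have conA: "connected A"
    unfolding A_def
  proof (rule connected_Un)
    show "connected (g ` {0..a})" "connected (g ` {b..1})"
      using ab by (auto intro!: connected_continuous_image cg)
    have "g 0 \<in> g ` {0..a}" "g 1 \<in> g ` {b..1}" using ab by auto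
    then show "g ` {0..a} \<inter> g ` {b..1} \<noteq> {}"
      using g(2) unfolding pathstart_def pathfinish_def by auto
  qed
  have "closed A"
    unfolding A_def using ab
    by (auto intro!: closed_Un compact_imp_closed compact_continuous_image cg)
  then have clT: "closed T"
    unfolding T_def by (auto intro!: closed_Un line_param_closed_image[OF h l'])
  have zT: "f \<zeta> \<notin> T"
  proof -
    have "f \<zeta> \<in> h ` {\<alpha><..<\<beta>}" using z by auto
    moreover have "A \<inter> h ` {\<alpha><..<\<beta>} = {}" using disjA e by simp
    ultimately have "f \<zeta> \<notin> A" "f \<zeta> \<notin> h ` ({..\<alpha>} \<union> {\<beta>..})" using disjh by blast+
    then show ?thesis unfolding T_def by simp
  qed
  obtain x where x: "l' \<inter> l = {x}"
    using cr unfolding crosses_once_def by blast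
  have int: "f s \<in> l' \<longleftrightarrow> s = \<zeta>" for s
  proof -
    have "f \<zeta> \<in> l' \<inter> l" using fD(4)[of \<zeta>] hD(4)[of \<eta>] z(1) by auto
    then have "l' \<inter> l = {f \<zeta>}" using x by simp
    then show ?thesis using fD(2,4) by blast
  qed
  obtain r where r: "0 < r" "ball (f \<zeta>) r \<subseteq> - T"
    using clT zT open_contains_ball[of "- T"] by (auto simp: closed_def)
  have "open (f -` ball (f \<zeta>) r)"
    using fD(1)[of UNIV] continuous_on_open_vimage[of UNIV f] by simp
  moreover have "\<zeta> \<in> f -` ball (f \<zeta>) r" using r by simp
  ultimately obtain d where d: "0 < d" "ball \<zeta> d \<subseteq> f -` ball (f \<zeta>) r"
    using open_contains_ball by blast
  \<comment> \<open>Parameters on either side of the crossing, close enough for both points to lie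
    in a ball free of \<open>T\<close>, and within the stretch that avoids the outside.\<close>
  define s where "s = max \<sigma> (\<zeta> - d / 2)"
  define t where "t = min \<tau> (\<zeta> + d / 2)"
  have s: "s < \<zeta>" "\<sigma> \<le> s" "s \<in> ball \<zeta> d" and t: "\<zeta> < t" "t \<le> \<tau>" "t \<in> ball \<zeta> d"
    using d st by (auto simp: s_def t_def dist_real_def)
  have ball: "f s \<in> ball (f \<zeta>) r" "f t \<in> ball (f \<zeta>) r"
    using d s t by auto
  have ccT: "connected_component (- T) (f s) (f t)"
    unfolding connected_component_def using ball r(2) connected_ball by blast
  have ins: "f u \<in> inside ?J" if "u \<in> {s, t}" for u
  proof -
    have u: "u \<noteq> \<zeta>" "u \<in> {\<sigma>..\<tau>}" "f u \<notin> T" using that s t ball r by auto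
    have "f u \<notin> h ` {\<alpha><..<\<beta>}"
    proof
      assume "f u \<in> h ` {\<alpha><..<\<beta>}"
      then have "f u \<in> l'" using hD(4) by auto
      then show False using int u by simp
    qed
    then have "f u \<notin> ?J"
      unfolding J e using u unfolding T_def by blast
    moreover have "f u \<notin> outside ?J" using Q u(2) by blast
    ultimately show ?thesis using inside_Un_outside[of ?J] by blast
  qed
  have "connected (inside ?J)" using Jordan_inside_outside[OF g] by blast
  then have ccS: "connected_component (- ?J) (f s) (f t)"
    unfolding connected_component_def using ins inside_no_overlap[of ?J] by blast
  have "connected (?J \<inter> T)" unfolding ST by (rule conA)
  \<comment> \<open>Neither the boundary nor \<open>T\<close> separates the two points, and they
    intersect in a connected set; hence their union, which contains \<open>l'\<close>, does not
    separate them either.\<close>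
  from Janiszewski[OF compact_simple_path_image[OF g(1)] clT this ccS ccT]
  have "connected_component (- (?J \<union> T)) (f s) (f t)" .
  moreover have "l' \<subseteq> ?J \<union> T"
  proof -
    have "range h \<subseteq> h ` {\<alpha><..<\<beta>} \<union> h ` ({..\<alpha>} \<union> {\<beta>..})" by force
    moreover have "h ` {\<alpha><..<\<beta>} \<subseteq> ?J" unfolding J e by simp
    ultimately show ?thesis unfolding hD(3) T_def by blast
  qed
  ultimately have cc: "connected_component (- l') (f s) (f t)"
    using connected_component_of_subset Compl_subset_Compl_iff by metis
  \<comment> \<open>Each half of \<open>l\<close> beside the crossing is connected and misses
    \<open>l'\<close>, and \<open>cc\<close> links the two halves.\<close>
  have all: "connected_component (- l') (f s) (f u)" if "u \<noteq> \<zeta>" for u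
  proof -
    have c1: "connected_component (- l') (f v) (f w)"
      if "v \<in> S" "w \<in> S" "connected S" "\<zeta> \<notin> S" for v w S
      unfolding connected_component_def
    proof (intro exI conjI)
      show "connected (f ` S)" using that fD(1) connected_continuous_image by blast
      show "f ` S \<subseteq> - l'" using that int by auto
    qed (use that in auto)
    show ?thesis
    proof (cases "u < \<zeta>")
      case True
      then show ?thesis using c1[of s "{..<\<zeta>}" u] s by simp
    next
      case False
      then show ?thesis
        using c1[of t "{\<zeta><..}" u] t that cc connected_component_trans by fastforce
    qed
  qed
  obtain A' B' where AB: "A' \<in> components (- l')" "B' \<in> components (- l')" "A' \<noteq> B'"
    "l \<inter> A' \<noteq> {}" "l \<inter> B' \<noteq> {}"
    using cr unfolding crosses_once_def by blast
  have "C = connected_component_set (- l') (f s)"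
    if C: "C \<in> components (- l')" "l \<inter> C \<noteq> {}" for C
  proof -
    obtain u where u: "f u \<in> C" using C fD(3) by blast
    then have "f u \<notin> l'" using in_components_subset[OF C(1)] by blast
    then have "u \<noteq> \<zeta>" using int by blast
    moreover obtain y where "C = connected_component_set (- l') y"
      using C(1) components_iff by blast
    ultimately show ?thesis
      using u all connected_component_eq by (metis mem_Collect_eq)
  qed
  then show False using AB by blast
qed

subsection \<open>Boundary walks\<close>

text \<open>\<open>(c + n - a) mod n\<close> is the number of forward steps from \<open>a\<close> to
  \<open>c\<close>. Membership in a walk becomes a bound on this distance, which
  \<open>mod_diff_nat\<close> resolves into cyclic order.\<close>

lemma walk_index:
  fixes a b n :: nat
  assumes "a < n" "m < n"
  shows "(\<exists>d. c = (a + d) mod n \<and> d \<le> m) \<longleftrightarrow> c < n \<and> (c + n - a) mod n \<le> m"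
proof
  assume "\<exists>d. c = (a + d) mod n \<and> d \<le> m"
  then obtain d where d: "c = (a + d) mod n" "d \<le> m" by blast
  have "(c + n - a) mod n = (c + (n - a)) mod n" using assms by simp
  also have "\<dots> = (a + d + (n - a)) mod n" unfolding d(1) by (simp add: mod_add_left_eq)
  also have "\<dots> = d" using assms d by simp
  finally show "c < n \<and> (c + n - a) mod n \<le> m" using d assms by simp
next
  assume c: "c < n \<and> (c + n - a) mod n \<le> m"
  have "(a + (c + n - a) mod n) mod n = c"
    using c assms by (simp add: mod_add_right_eq)
  then show "\<exists>d. c = (a + d) mod n \<and> d \<le> m" using c by metis
qed

lemma mod_diff_nat:
  fixes a c n :: nat
  assumes "a < n" "c < n"
  shows "(c + n - a) mod n = (if a \<le> c then c - a else c + n - a)"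
  using assms by (auto simp: le_mod_geq)

lemma mem_walk_vertices:
  assumes "a < n" "b < n"
  shows "c \<in> walk_vertices n a b \<longleftrightarrow> c < n \<and> (c = a \<or> c = b \<or> cyc a c b)"
proof -
  have "c \<in> walk_vertices n a b \<longleftrightarrow> c < n \<and> (c + n - a) mod n \<le> (b + n - a) mod n"
    unfolding walk_vertices_def using walk_index[OF assms(1), of "(b + n - a) mod n" c] assms
    by auto
  also have "\<dots> \<longleftrightarrow> c < n \<and> (c = a \<or> c = b \<or> cyc a c b)"
    using assms by (auto simp: mod_diff_nat cyc_def split: if_splits)
  finally show ?thesis .
qed

text \<open>An edge bears the index of its first vertex, so \<open>a\<close> is included and
  \<open>b\<close> is not.\<close>

lemma mem_walk_edges:
  assumes "a < n" "b < n"
  shows "m \<in> walk_edges n a b \<longleftrightarrow> m < n \<and> a \<noteq> b \<and> (m = a \<or> cyc a m b)"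
proof (cases "a = b")
  case False
  then have d: "0 < (b + n - a) mod n" using assms by (auto simp: mod_diff_nat)
  then have "m \<in> walk_edges n a b \<longleftrightarrow> (\<exists>d. m = (a + d) mod n \<and> d \<le> (b + n - a) mod n - 1)"
    unfolding walk_edges_def by (auto simp: less_eq_Suc_le le_diff_conv2)
  also have "\<dots> \<longleftrightarrow> m < n \<and> (m + n - a) mod n \<le> (b + n - a) mod n - 1"
    by (rule walk_index[OF assms(1)]) (use assms in \<open>auto simp: less_imp_diff_less\<close>)
  also have "\<dots> \<longleftrightarrow> m < n \<and> a \<noteq> b \<and> (m = a \<or> cyc a m b)"
    using assms d False by (auto simp: mod_diff_nat cyc_def split: if_splits)
  finally show ?thesis .
qed (use assms in \<open>auto simp: walk_edges_def\<close>)

lemma Suc_mod_eq: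
  "m < n \<Longrightarrow> Suc m mod n = (if Suc m = n then 0 else Suc m)"
  by auto

lemma walk_vertices_Suc_mod:
  assumes "k < n" "j < n" "k \<noteq> j" "t \<in> walk_vertices n (Suc k mod n) j"
  shows "t < n" "t = j \<or> cyc k t j"
proof -
  define l where "l = Suc k mod n"
  have l: "l < n" "l = j \<or> cyc k l j"
    using assms(1-3) by (auto simp: l_def cyc_def Suc_mod_eq)
  then have t: "t < n" "t = l \<or> t = j \<or> cyc l t j"
    using assms(4) mem_walk_vertices[OF l(1) assms(2)] unfolding l_def by auto
  then show "t < n" by simp
  have "cyc k t j" if "cyc k l j" "cyc l t j"
    using that cyc_trans(1) cyc_rotate by metis
  then show "t = j \<or> cyc k t j"
    using l(2) t(2) cyc_distinct(2) by metis
qed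

text \<open>Boundary parameters are scaled by \<open>n\<close>: integers are vertices, and the
  values strictly between \<open>m\<close> and \<open>Suc m\<close> are the interior of edge
  \<open>m\<close>.\<close>

lemma walk_edge_between:
  assumes "a < n" "b < n" "m \<in> walk_edges n a b" "real m < s" "s < real (Suc m)"
  shows "cyc (real a) s (real b)"
proof -
  have m: "m < n" "a \<noteq> b" "m = a \<or> cyc a m b"
    using assms mem_walk_edges by auto
  \<comment> \<open>The walk does not pass index 0, or it does and the edge comes before or after
    that passage.\<close>
  consider "Suc m \<le> b" "a \<le> m" | "b < a" "a \<le> m" | "b < a" "Suc m \<le> b"
    using m unfolding cyc_def by linarith
  then show ?thesis
    using assms(4,5) by cases (auto simp: cyc_def)
qed

text \<open>Ensures that the edge through which the ray behind a blocker exits does not have the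
  blocker as an end point.\<close>

lemma walk_edge_ends:
  assumes "a < n" "b < n" "m \<in> walk_edges n a b" "cyc b k a" "k < n"
  shows "k \<noteq> m" "k \<noteq> Suc m mod n"
proof -
  have m: "m < n" "a \<noteq> b" "m = a \<or> cyc a m b"
    using assms mem_walk_edges by auto
  show "k \<noteq> m" "k \<noteq> Suc m mod n"
    using m assms(1,2,4,5) by (auto simp: cyc_def Suc_mod_eq split: if_splits)
qed

subsection \<open>Chords of a pseudo-polygon\<close>

text \<open>Fixes a closed boundary walk as supplied by \<open>counterclockwise\<close>, with vertex
  \<open>i\<close> at parameter \<open>i / n\<close>, so that positions on the boundary become
  numbers.\<close>

locale pseudo_polygon_walk =
  fixes n :: nat and p :: "nat \<Rightarrow> complex" and \<L> :: "complex set set" and g :: "real \<Rightarrow> complex"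
  assumes config: "pseudo_configuration n p \<L>"
    and g: "simple_path g" "pathfinish g = pathstart g"
    and g_vertex: "i < n \<Longrightarrow> g (real i / real n) = p i"
    and g_edge: "i < n \<Longrightarrow> g ` {real i / real n .. real (Suc i) / real n} = edge n p \<L> i"
begin

lemma n3: "3 \<le> n" and n_pos: "0 < real n"
  using config unfolding pseudo_configuration_def by auto

lemma p_eq_iff: "i < n \<Longrightarrow> j < n \<Longrightarrow> p i = p j \<longleftrightarrow> i = j"
  using config unfolding pseudo_configuration_def inj_on_def by auto

lemma Suc_mod: "m < n \<Longrightarrow> Suc m mod n < n" "m < n \<Longrightarrow> Suc m mod n \<noteq> m"
  using n3 by (auto simp: Suc_mod_eq)

lemma g_Suc_vertex: "m < n \<Longrightarrow> g (real (Suc m) / real n) = p (Suc m mod n)"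
proof (cases "Suc m = n")
  case True
  then show ?thesis
    using g(2) g_vertex[of 0] n3 by (simp add: pathstart_def pathfinish_def)
next
  case False
  assume "m < n"
  with False show ?thesis using g_vertex[of "Suc m"] by simp
qed

lemma boundary_eq: "boundary n p \<L> = path_image g"
proof -
  have "\<exists>i<n. x \<in> {real i / real n .. real (Suc i) / real n}" if "0 \<le> x" "x \<le> 1" for x :: real
  proof (cases "x = 1")
    case True
    then show ?thesis using n3 by (intro exI[of _ "n - 1"]) (auto simp: field_simps)
  next
    case False
    \<comment> \<open>The index of the parameter interval containing \<open>x\<close>; the value 1
      is treated separately because the floor would give \<open>n\<close>.\<close>
    define i where "i = nat \<lfloor>x * n\<rfloor>"
    have "real i \<le> x * n" "x * n < real i + 1"
      unfolding i_def using that n_pos by (auto simp: of_nat_nat)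
    moreover have "x * n < n" using False that n_pos by simp
    ultimately have "real i < real n" "x \<in> {real i / real n .. real (Suc i) / real n}"
      using n_pos by (linarith, auto simp: field_simps)
    then show ?thesis by auto
  qed
  moreover have "{real i / real n .. real (Suc i) / real n} \<subseteq> {0..1}" if "i < n" for i
    using that n_pos by (auto simp: field_simps)
  ultimately have "(\<Union>i<n. {real i / real n .. real (Suc i) / real n}) = {0..1}"
    by fastforce
  then show ?thesis
    unfolding boundary_def path_image_def using g_edge by (simp add: image_UN[symmetric] flip: g_edge)
qed

section \<open>Lines, segments and rays spanned by vertices\<close>

lemma pseudo_lineD:
  assumes "l \<in> \<L>"
  shows "pseudo_line l" "closed l"
  using assms config
  unfolding pseudo_configuration_def pseudo_line_arrangement_def pseudo_line_def by auto

lemma lines_cross: "l \<in> \<L> \<Longrightarrow> m \<in> \<L> \<Longrightarrow> l \<noteq> m \<Longrightarrow> crosses_once l m"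
  using config unfolding pseudo_configuration_def pseudo_line_arrangement_def by auto

lemma ex1_line: "i < n \<Longrightarrow> j < n \<Longrightarrow> i \<noteq> j \<Longrightarrow> \<exists>!l. l \<in> \<L> \<and> p i \<in> l \<and> p j \<in> l"
  using config unfolding pseudo_configuration_def by blast

lemma line_mem:
  assumes "i < n" "j < n" "i \<noteq> j"
  shows "line p \<L> i j \<in> \<L>" "p i \<in> line p \<L> i j" "p j \<in> line p \<L> i j"
  using theI'[OF ex1_line[OF assms]] unfolding line_def by blast+

lemma line_commute: "line p \<L> i j = line p \<L> j i"
  unfolding line_def by (simp add: conj_commute)

lemma segment_commute: "segment p \<L> i j = segment p \<L> j i"
  unfolding segment_def line_commute[of i j] by (rule subsegment_commute)

lemma sees_commute: "sees n p \<L> i j \<longleftrightarrow> sees n p \<L> j i"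
  unfolding sees_def segment_commute[of i j] by (rule refl)

lemma vertex_on_line:
  assumes "i < n" "j < n" "i \<noteq> j" "k < n" "p k \<in> line p \<L> i j"
  shows "k = i \<or> k = j"
proof -
  have "card (line p \<L> i j \<inter> p ` {..<n}) = 2"
    using config line_mem(1)[OF assms(1-3)] unfolding pseudo_configuration_def by blast
  moreover have "{p i, p j} \<subseteq> line p \<L> i j \<inter> p ` {..<n}" "card {p i, p j} = 2"
    using line_mem[OF assms(1-3)] assms p_eq_iff by auto
  ultimately have "{p i, p j} = line p \<L> i j \<inter> p ` {..<n}"
    by (metis card_subset_eq card.infinite zero_neq_numeral)
  then have "p k \<in> {p i, p j}" using assms by auto
  then show ?thesis using assms p_eq_iff by auto
qed

text \<open>The lines differ because a third vertex cannot lie on either, and distinct lines share a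
  single point.\<close>

lemma lines_through_vertex:
  assumes "i < n" "j < n" "k < n" "i \<noteq> j" "i \<noteq> k" "j \<noteq> k"
  shows "line p \<L> i j \<inter> line p \<L> i k = {p i}"
proof -
  have "line p \<L> i j \<noteq> line p \<L> i k"
    using vertex_on_line[of i j k] line_mem(3)[of i k] assms by auto
  then obtain x where "line p \<L> i j \<inter> line p \<L> i k = {x}"
    using lines_cross line_mem(1) assms unfolding crosses_once_def by meson
  moreover have "p i \<in> line p \<L> i j \<inter> line p \<L> i k" using line_mem assms by auto
  ultimately show ?thesis by auto
qed

lemma line_param_vertices:
  assumes "i < n" "k < n" "i \<noteq> k"
  obtains f \<alpha> \<beta> where "line_param f (line p \<L> i k)" "\<alpha> < \<beta>" "f \<alpha> = p i" "f \<beta> = p k"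
    "segment p \<L> i k = f ` {\<alpha>..\<beta>}" "ray p \<L> k i = f ` {\<beta>..}" "ray p \<L> i k = f ` {..\<alpha>}"
proof -
  note l = line_mem[OF assms]
  obtain f \<alpha> \<beta> where f: "line_param f (line p \<L> i k)" "\<alpha> < \<beta>" "f \<alpha> = p i" "f \<beta> = p k"
    using line_param_through[OF pseudo_lineD(1)[OF l(1)] l(2,3)] p_eq_iff assms by metis
  show ?thesis
  proof (rule that[OF f])
    show "segment p \<L> i k = f ` {\<alpha>..\<beta>}"
      using subsegment_line_param[OF f(1,2)] f(3,4) unfolding segment_def by simp
    show "ray p \<L> k i = f ` {\<beta>..}"
      using subray_line_param[OF f(1) pseudo_lineD(2)[OF l(1)] f(2)] f(3,4)
      unfolding ray_def line_commute[of k i] by simp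
    show "ray p \<L> i k = f ` {..\<alpha>}"
      using subray_line_param_left[OF f(1) pseudo_lineD(2)[OF l(1)] f(2)] f(3,4)
      unfolding ray_def by simp
  qed
qed

lemma segment_subset_line: "i < n \<Longrightarrow> k < n \<Longrightarrow> i \<noteq> k \<Longrightarrow> segment p \<L> i k \<subseteq> line p \<L> i k"
proof -
  assume ik: "i < n" "k < n" "i \<noteq> k"
  obtain f \<alpha> \<beta> where "line_param f (line p \<L> i k)" "segment p \<L> i k = f ` {\<alpha>..\<beta>}"
    using line_param_vertices[OF ik] by metis
  then show ?thesis using line_paramD(4) by auto
qed

lemma ray_facts:
  assumes "i < n" "k < n" "i \<noteq> k"
  shows "ray p \<L> k i \<subseteq> line p \<L> i k" "p i \<notin> ray p \<L> k i" "ray p \<L> k i \<inter> ray p \<L> i k = {}"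
proof -
  obtain f \<alpha> \<beta> where f: "line_param f (line p \<L> i k)" "\<alpha> < \<beta>" "f \<alpha> = p i" "f \<beta> = p k"
    "segment p \<L> i k = f ` {\<alpha>..\<beta>}" "ray p \<L> k i = f ` {\<beta>..}" "ray p \<L> i k = f ` {..\<alpha>}"
    using line_param_vertices[OF assms] by blast
  note fD = line_paramD[OF f(1)]
  show "ray p \<L> k i \<subseteq> line p \<L> i k" using fD(4) f(6) by auto
  show "p i \<notin> ray p \<L> k i" unfolding f(6) f(3)[symmetric] using fD(2) f(2) by auto
  show "ray p \<L> k i \<inter> ray p \<L> i k = {}" unfolding f(6,7) using fD(2) f(2) by auto
qed

text \<open>The two lines meet only in \<open>p i\<close>, which is not on the ray behind
  \<open>p k\<close>. This keeps exit chords away from lines of sight from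
  \<open>p i\<close>.\<close>

lemma ray_disjoint_line:
  assumes "i < n" "k < n" "t < n" "i \<noteq> k" "i \<noteq> t" "k \<noteq> t"
  shows "ray p \<L> k i \<inter> line p \<L> i t = {}"
proof -
  have "ray p \<L> k i \<inter> line p \<L> i t \<subseteq> {p i}"
    using ray_facts(1)[of i k] lines_through_vertex[of i k t] assms by auto
  then show ?thesis using ray_facts(2)[of i k] assms by auto
qed

section \<open>From visibility and exits to chords\<close>

text \<open>Otherwise the edge spans a different line. The touching point is no vertex, hence
  interior to the edge, and by \<open>crossing_edge_leaves_region\<close> the stretch would reach
  the outside there.\<close>

lemma interior_touches_own_edge:
  assumes ik: "i < n" "k < n" "i \<noteq> k" and f: "line_param f (line p \<L> i k)"
    and Q: "f ` {\<sigma>..\<tau>} \<subseteq> - outside (path_image g)" and z: "\<sigma> < \<zeta>" "\<zeta> < \<tau>"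
    and nv: "f \<zeta> \<noteq> p i" "f \<zeta> \<noteq> p k"
    and m: "m < n" "f \<zeta> \<in> edge n p \<L> m"
  shows "{i, k} = {m, Suc m mod n}"
proof (rule ccontr)
  assume ne: "{i, k} \<noteq> {m, Suc m mod n}"
  define m' where "m' = Suc m mod n"
  have m': "m' < n" "m' \<noteq> m" using Suc_mod m m'_def by auto
  have lne: "line p \<L> m m' \<noteq> line p \<L> i k"
  proof
    assume eq: "line p \<L> m m' = line p \<L> i k"
    have "m = i \<or> m = k" "m' = i \<or> m' = k"
      using vertex_on_line[OF ik] line_mem[of m m'] m m' eq by auto
    then show False using ne m' m'_def by auto
  qed
  have notv: "f \<zeta> \<noteq> p j" if "j < n" for j
    using vertex_on_line[OF ik that] line_paramD(4)[OF f, of \<zeta>] nv by metis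
  obtain h \<alpha> \<beta> where h: "line_param h (line p \<L> m m')" "\<alpha> < \<beta>" "h \<alpha> = p m" "h \<beta> = p m'"
    "segment p \<L> m m' = h ` {\<alpha>..\<beta>}"
    using line_param_vertices[of m m'] m m' by metis
  note hD = line_paramD[OF h(1)]
  have edge: "edge n p \<L> m = h ` {\<alpha>..\<beta>}"
    using h(5) unfolding edge_def m'_def .
  let ?a = "real m / real n" and ?b = "real (Suc m) / real n"
  have ab: "0 \<le> ?a" "?a < ?b" "?b \<le> 1"
    using n_pos m(1) by (auto simp: field_simps)
  obtain \<eta> where \<eta>: "f \<zeta> = h \<eta>" "\<alpha> \<le> \<eta>" "\<eta> \<le> \<beta>"
    using m(2) unfolding edge by auto
  have "\<eta> \<noteq> \<alpha>" "\<eta> \<noteq> \<beta>" using \<eta>(1) h(3,4) notv m(1) m'(1) by auto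
  have "g ` {?a<..<?b} = h ` {\<alpha><..<\<beta>}"
  proof -
    have 1: "g ` {?a<..<?b} = g ` {?a..?b} - {g ?a, g ?b}"
    proof -
      have "g s \<noteq> g ?a \<and> g s \<noteq> g ?b" if "?a < s" "s < ?b" for s
        using simple_path_inj_interior[OF g(1), of s ?a]
          simple_path_inj_interior[OF g(1), of s ?b] that ab by linarith
      moreover have "{?a<..<?b} = {?a..?b} - {?a, ?b}" by auto
      ultimately show ?thesis by auto
    qed
    have "h ` {\<alpha><..<\<beta>} = h ` {\<alpha>..\<beta>} - {h \<alpha>, h \<beta>}"
      using hD(2) h(2) by (auto simp: less_le)
    then show ?thesis
      unfolding 1 g_edge[OF m(1)] g_vertex[OF m(1)] g_Suc_vertex[OF m(1)] edge h(3,4) m'_def by simp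
  qed
  moreover have "crosses_once (line p \<L> m m') (line p \<L> i k)"
    using lines_cross line_mem(1) lne ik m m' by metis
  moreover have "closed (line p \<L> m m')"
    using pseudo_lineD(2) line_mem(1)[OF m(1) m'(1)] m'(2) by metis
  moreover have "\<alpha> < \<eta>" "\<eta> < \<beta>" using \<eta>(2,3) \<open>\<eta> \<noteq> \<alpha>\<close> \<open>\<eta> \<noteq> \<beta>\<close> by simp_all
  ultimately have "\<not> f ` {\<sigma>..\<tau>} \<subseteq> - outside (path_image g)"
    using crossing_edge_leaves_region[OF g f h(1) _ _ \<eta>(1) _ _ ab _ z] by blast
  then show False using Q by blast
qed

lemma in_edge_or_inside:
  assumes "z \<notin> outside (path_image g)"
  obtains m where "m < n" "z \<in> edge n p \<L> m" | "z \<in> inside (path_image g)"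
  using assms inside_Un_outside[of "path_image g"] boundary_eq unfolding boundary_def by blast

text \<open>An interior point of the segment on the boundary would make the segment itself an edge,
  which non-adjacency rules out.\<close>

lemma chord_of_visible_pair:
  assumes ik: "i < n" "k < n" "i \<noteq> k" and sees: "sees n p \<L> i k"
    and nonadj: "k \<noteq> Suc i mod n" "i \<noteq> Suc k mod n"
  shows "chord g (real i / real n) (real k / real n) (segment p \<L> i k)"
proof -
  obtain f \<alpha> \<beta> where f: "line_param f (line p \<L> i k)" "\<alpha> < \<beta>" "f \<alpha> = p i" "f \<beta> = p k"
    and seg: "segment p \<L> i k = f ` {\<alpha>..\<beta>}"
    using line_param_vertices[OF ik] by metis
  note fD = line_paramD[OF f(1)] and arc = arc_line_param[OF f(1,2)]
  have Q: "f ` {\<alpha>..\<beta>} \<subseteq> - outside (path_image g)"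
    using sees unfolding sees_def seg boundary_eq by blast
  have "f \<zeta> \<in> inside (path_image g)" if z: "\<zeta> \<in> {\<alpha>..\<beta>}" "f \<zeta> \<noteq> p i" "f \<zeta> \<noteq> p k" for \<zeta>
  proof -
    have z': "\<alpha> < \<zeta>" "\<zeta> < \<beta>" using z f(3,4) by (auto simp: less_le)
    have "f \<zeta> \<notin> outside (path_image g)" using Q z by blast
    then show ?thesis
    proof (cases rule: in_edge_or_inside)
      case (1 m)
      then have "{i, k} = {m, Suc m mod n}"
        using interior_touches_own_edge[OF ik f(1) Q z' z(2,3)] by blast
      then show ?thesis using nonadj ik by (auto simp: doubleton_eq_iff)
    qed
  qed
  then have "f ` {\<alpha>..\<beta>} - {p i, p k} \<subseteq> inside (path_image g)" by blast
  then show ?thesis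
    unfolding chord_def seg g_vertex[OF ik(1)] g_vertex[OF ik(2)]
    using arc f(3,4) by (intro exI[of _ "f \<circ> linepath \<alpha> \<beta>"]) simp
qed

text \<open>The exit point is not \<open>p k\<close>, which is off the line of edge
  \<open>m\<close>, and no other vertex lies on the ray; so the exit is interior to edge
  \<open>m\<close> and \<open>s\<close> is not an integer. Before the exit the ray stays
  inside.\<close>

lemma chord_of_exit:
  assumes ik: "i < n" "k < n" "i \<noteq> k" and m: "m < n" "k \<noteq> m" "k \<noteq> Suc m mod n"
    and ex: "first_exits_through (ray p \<L> k i) (p k) (- outside (boundary n p \<L>)) (edge n p \<L> m)"
  obtains s C where "real m < s" "s < real (Suc m)" "C \<subseteq> ray p \<L> k i"
    "chord g (real k / real n) (s / real n) C"
proof -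
  obtain f \<alpha> \<beta> where f: "line_param f (line p \<L> i k)" "\<alpha> < \<beta>" "f \<alpha> = p i" "f \<beta> = p k"
    and seg: "segment p \<L> i k = f ` {\<alpha>..\<beta>}" and ray: "ray p \<L> k i = f ` {\<beta>..}"
    using line_param_vertices[OF ik] by metis
  note fD = line_paramD[OF f(1)]
  obtain \<xi> where x: "\<beta> \<le> \<xi>" "f ` {\<beta>..\<xi>} \<subseteq> - outside (path_image g)" "f \<xi> \<in> edge n p \<L> m"
    using first_exits_through_line_param[OF f(1), of \<beta>] ex f(4) unfolding ray boundary_eq by metis
  have edge_line: "edge n p \<L> j \<subseteq> line p \<L> j (Suc j mod n)" if "j < n" for j
    using segment_subset_line[of j "Suc j mod n"] Suc_mod[OF that] that unfolding edge_def by auto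
  have "\<beta> \<noteq> \<xi>"
  proof
    assume "\<beta> = \<xi>"
    then have "p k \<in> line p \<L> m (Suc m mod n)" using x(3) f(4) edge_line[OF m(1)] by auto
    then show False using vertex_on_line[of m "Suc m mod n" k] m ik Suc_mod[OF m(1)] by auto
  qed
  then have bx: "\<beta> < \<xi>" using x by simp
  note arc = arc_line_param[OF f(1) bx]
  have nv: "f \<zeta> \<noteq> p j" if "\<beta> < \<zeta>" "j < n" for \<zeta> j
  proof
    assume eq: "f \<zeta> = p j"
    then have "j = i \<or> j = k" using vertex_on_line[OF ik that(2)] fD(4) by metis
    then have "f \<zeta> = f \<alpha> \<or> f \<zeta> = f \<beta>" using eq f(3,4) by auto
    then show False using fD(2) f(2) that(1) by auto
  qed
  let ?a = "real m / real n" and ?b = "real (Suc m) / real n"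
  obtain u where u: "f \<xi> = g u" "?a \<le> u" "u \<le> ?b"
    using x(3) unfolding g_edge[OF m(1), symmetric] by auto
  have "u \<noteq> ?a" "u \<noteq> ?b"
    using u(1) nv[OF bx] g_vertex[OF m(1)] g_Suc_vertex[OF m(1)] m(1) Suc_mod(1)[OF m(1)] by metis+
  then have "?a < u" "u < ?b" using u(2,3) by linarith+
  then have s: "real m < u * n" "u * n < real (Suc m)"
    using pos_divide_less_eq[OF n_pos] pos_less_divide_eq[OF n_pos] by blast+
  have "f \<zeta> \<in> inside (path_image g)" if z: "\<zeta> \<in> {\<beta>..\<xi>}" "f \<zeta> \<noteq> p k" "f \<zeta> \<noteq> f \<xi>" for \<zeta>
  proof -
    have z': "\<beta> < \<zeta>" "\<zeta> < \<xi>" using z f(4) by (auto simp: less_le)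
    have "f \<zeta> \<notin> outside (path_image g)" using x(2) z by blast
    then show ?thesis
    proof (cases rule: in_edge_or_inside)
      case (1 j)
      then have "{i, k} = {j, Suc j mod n}"
        using interior_touches_own_edge[OF ik f(1) x(2) z'] nv[OF z'(1)] ik by blast
      \<comment> \<open>The only edge that could be touched is the segment from \<open>p i\<close>
        to \<open>p k\<close> itself, whose parameters end at \<beta>.\<close>
      then have "edge n p \<L> j = segment p \<L> i k"
        unfolding edge_def using segment_commute by (metis doubleton_eq_iff)
      then show ?thesis using 1(2) fD(2) z'(1) unfolding seg by auto
    qed
  qed
  then have "f ` {\<beta>..\<xi>} - {p k, f \<xi>} \<subseteq> inside (path_image g)" by blast
  then have "chord g (real k / real n) (u * n / real n) (f ` {\<beta>..\<xi>})"
    unfolding chord_def g_vertex[OF ik(2)]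
    using arc f(4) u(1) n_pos by (intro exI[of _ "f \<circ> linepath \<beta> \<xi>"]) simp
  moreover have "f ` {\<beta>..\<xi>} \<subseteq> ray p \<L> k i" unfolding ray by auto
  ultimately show ?thesis using that s by blast
qed

lemma interlaced_polygon_chords_meet:
  assumes "chord g (a / real n) (b / real n) C" "chord g (a' / real n) (b' / real n) C'"
    and "cyc a a' b" "cyc b b' a" "{a, b, a', b'} \<subseteq> {0..<real n}"
  shows "C \<inter> C' \<noteq> {}"
proof (rule interlaced_chords_meet[OF g _ _ _ assms(1,2)])
  show "{a / real n, b / real n, a' / real n, b' / real n} \<subseteq> {0..<1}"
    using assms(5) n_pos by auto
qed (use assms(3,4) n_pos in simp_all)

text \<open>The cyclic order is \<open>k\<close>, \<open>t\<close>, \<open>s\<close>,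
  \<open>i\<close>, so a chord from \<open>p i\<close> to \<open>p t\<close> would interlace with
  \<open>C\<close> and meet it. Adjacent vertices need a separate argument, since their segment is
  no chord.\<close>

lemma chord_separates_visible_pair:
  assumes it: "i < n" "t < n" "i \<noteq> t" and "k < n"
    and s: "m < n" "real m < s" "s < real (Suc m)"
    and C: "chord g (real k / real n) (s / real n) C" "C \<inter> line p \<L> i t = {}"
    and cyc: "cyc (real k) (real t) s" "cyc s (real i) (real k)"
  shows "\<not> sees n p \<L> i t"
proof
  assume "sees n p \<L> i t"
  have "s < real n" using s by linarith
  \<comment> \<open>Going forward from \<open>i\<close>, the vertex \<open>k\<close> comes before
    \<open>t\<close>.\<close>
  have "t \<noteq> Suc i mod n"
    using cyc it \<open>k < n\<close> \<open>s < real n\<close> s by (auto simp: cyc_def Suc_mod_eq split: if_splits)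
  moreover have "i \<noteq> Suc t mod n"
  proof
    \<comment> \<open>Then \<open>s\<close> lies on the edge from \<open>t\<close> to
      \<open>i\<close>, so the end of \<open>C\<close> is on the line that \<open>C\<close>
      avoids.\<close>
    assume i: "i = Suc t mod n"
    have "real t < s" "s < real (Suc t)"
      using i cyc it \<open>k < n\<close> \<open>s < real n\<close> s by (auto simp: cyc_def Suc_mod_eq split: if_splits)
    then have "g (s / real n) \<in> g ` {real t / real n .. real (Suc t) / real n}"
      using n_pos by (intro imageI) (auto simp: divide_right_mono)
    then have "g (s / real n) \<in> segment p \<L> t i"
      unfolding g_edge[OF it(2)] edge_def i .
    then have "g (s / real n) \<in> line p \<L> i t"
      using segment_subset_line[of t i] line_commute[of i t] it by auto
    moreover have "g (s / real n) \<in> C"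
      using C(1) pathfinish_in_path_image unfolding chord_def by metis
    ultimately show False using C(2) by blast
  qed
  ultimately have "chord g (real i / real n) (real t / real n) (segment p \<L> i t)"
    using chord_of_visible_pair[OF it \<open>sees n p \<L> i t\<close>] by blast
  then have "chord g (real t / real n) (real i / real n) (segment p \<L> i t)"
    using chord_commute by blast
  then have "C \<inter> segment p \<L> i t \<noteq> {}"
    using interlaced_polygon_chords_meet[OF C(1) _ cyc] it \<open>k < n\<close> \<open>s < real n\<close> s by auto
  then show False using C(2) segment_subset_line[OF it] by blast
qed

subsection \<open>Designated blockers\<close>

text \<open>The two alternatives of the definition, with the exit edge replaced by an exit chord in
  known cyclic position. The case \<open>ahead\<close> also keeps the exit itself, from which
  \<open>designated_blocker_beyond\<close> rebuilds a blocker.\<close>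

lemma designated_blockerE:
  assumes "designated_blocker n p \<L> i j k"
  obtains (ahead) m s C where "cyc i k j" "m \<in> walk_edges n j i"
      "first_exits_through (ray p \<L> k i) (p k) (- outside (boundary n p \<L>)) (edge n p \<L> m)"
      "m < n" "real m < s" "s < real (Suc m)" "cyc (real j) s (real i)"
      "C \<subseteq> ray p \<L> k i" "chord g (real k / real n) (s / real n) C"
  | (behind) m s C where "cyc j k i" "m \<in> walk_edges n i j"
      "m < n" "real m < s" "s < real (Suc m)" "cyc (real i) s (real j)"
      "C \<subseteq> ray p \<L> k i" "chord g (real k / real n) (s / real n) C"
proof -
  have ij: "i < n" "j < n" "k < n" "k \<noteq> i" "k \<noteq> j"
    using assms unfolding designated_blocker_def invisible_pair_def by auto
  have exit: "m < n \<and> (\<exists>s C. real m < s \<and> s < real (Suc m) \<and> cyc (real a) s (real b) \<and>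
      C \<subseteq> ray p \<L> k i \<and> chord g (real k / real n) (s / real n) C)"
    if "m \<in> walk_edges n a b" "a < n" "b < n" "cyc b k a"
      and ex: "first_exits_through (ray p \<L> k i) (p k) (- outside (boundary n p \<L>)) (edge n p \<L> m)"
    for m a b
  proof -
    have "m < n" using that(1) mem_walk_edges[OF that(2,3)] by blast
    moreover have "k \<noteq> m" "k \<noteq> Suc m mod n"
      using walk_edge_ends[OF that(2,3,1,4) ij(3)] by auto
    ultimately obtain s C where "real m < s" "s < real (Suc m)" "C \<subseteq> ray p \<L> k i"
      "chord g (real k / real n) (s / real n) C"
      using chord_of_exit[of i k m] ex ij by metis
    then show ?thesis using \<open>m < n\<close> walk_edge_between[OF that(2,3,1)] by blast
  qed
  from assms consider
    m where "k \<in> walk_vertices n i j" "m \<in> walk_edges n j i"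
      "first_exits_through (ray p \<L> k i) (p k) (- outside (boundary n p \<L>)) (edge n p \<L> m)"
  | m where "k \<in> walk_vertices n j i" "m \<in> walk_edges n i j"
      "first_exits_through (ray p \<L> k i) (p k) (- outside (boundary n p \<L>)) (edge n p \<L> m)"
    unfolding designated_blocker_def by blast
  then show ?thesis
  proof cases
    case (1 m)
    then have "cyc i k j" using mem_walk_vertices[OF ij(1,2)] ij by blast
    moreover obtain s C where "m < n" "real m < s" "s < real (Suc m)" "cyc (real j) s (real i)"
      "C \<subseteq> ray p \<L> k i" "chord g (real k / real n) (s / real n) C"
      using exit[OF 1(2) ij(2,1) \<open>cyc i k j\<close> 1(3)] by blast
    ultimately show ?thesis using 1(2,3) by (intro ahead)
  next
    case (2 m)
    then have "cyc j k i" using mem_walk_vertices[OF ij(2,1)] ij by blast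
    moreover obtain s C where "m < n" "real m < s" "s < real (Suc m)" "cyc (real i) s (real j)"
      "C \<subseteq> ray p \<L> k i" "chord g (real k / real n) (s / real n) C"
      using exit[OF 2(2) ij(1,2) \<open>cyc j k i\<close> 2(3)] by blast
    ultimately show ?thesis using 2(2) by (intro behind)
  qed
qed

lemma blocked_beyond:
  assumes "i < n" "k < n" "t < n" "cyc i k t"
    and "m < n" "real m < s" "s < real (Suc m)" "cyc (real t) s (real i)"
    and C: "C \<subseteq> ray p \<L> k i" "chord g (real k / real n) (s / real n) C"
  shows "\<not> sees n p \<L> i t"
proof (rule chord_separates_visible_pair)
  have ne: "i \<noteq> k" "i \<noteq> t" "k \<noteq> t" using \<open>cyc i k t\<close> by (auto simp: cyc_def)
  then show "C \<inter> line p \<L> i t = {}" using ray_disjoint_line[of i k t] C assms by blast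
  show "cyc (real k) (real t) s" "cyc s (real i) (real k)"
    using assms(4,8) by (auto simp: cyc_def)
  show "i \<noteq> t" by (fact ne)
qed (use assms in auto)

text \<open>Mirror image of \<open>blocked_beyond\<close>: with the orientation reversed,
  \<open>i\<close> and \<open>t\<close> exchange roles in the separation lemma.\<close>

lemma blocked_behind:
  assumes "i < n" "k < n" "t < n" "cyc t k i"
    and "m < n" "real m < s" "s < real (Suc m)" "cyc (real i) s (real t)"
    and C: "C \<subseteq> ray p \<L> k i" "chord g (real k / real n) (s / real n) C"
  shows "\<not> sees n p \<L> i t"
proof -
  have ne: "i \<noteq> k" "i \<noteq> t" "k \<noteq> t" using \<open>cyc t k i\<close> by (auto simp: cyc_def)
  then have "C \<inter> line p \<L> t i = {}"
    using ray_disjoint_line[of i k t] C assms(1-3) unfolding line_commute[of t i] by blast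
  moreover have "cyc (real k) (real i) s" "cyc s (real t) (real k)"
    using assms(4,8) by (auto simp: cyc_def)
  ultimately have "\<not> sees n p \<L> t i"
    using chord_separates_visible_pair[of t i k m s C] assms ne by auto
  then show ?thesis using sees_commute by blast
qed

text \<open>Of two blockers on the same side of the pair, the one nearer to \<open>p i\<close> hides
  the other. On different sides, \<open>cyc_two_chords\<close> leaves either one chord hiding the
  other blocker or two interlaced chords; the latter would meet, but their lines share only
  \<open>p i\<close>, which is not on \<open>C\<close>.\<close>

lemma designated_blocker_unique:
  assumes k: "designated_blocker n p \<L> i j k" and "cyc i k j"
    and k': "designated_blocker n p \<L> i j k'"
  shows "k' = k"
proof (rule ccontr)
  assume "k' \<noteq> k"
  have idx: "i < n" "j < n" "k < n" "k' < n" "i \<noteq> j" "k' \<noteq> i" "k' \<noteq> j"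
    and vis: "sees n p \<L> i k" "sees n p \<L> i k'"
    using k k' unfolding designated_blocker_def invisible_pair_def by auto
  have nocyc: "\<not> cyc j k i" using \<open>cyc i k j\<close> by (auto simp: cyc_def)
  obtain m s C where E: "m < n" "real m < s" "s < real (Suc m)" "cyc (real j) s (real i)"
    "C \<subseteq> ray p \<L> k i" "chord g (real k / real n) (s / real n) C"
    using k nocyc by (cases rule: designated_blockerE) auto
  from k' show False
  proof (cases rule: designated_blockerE)
    case (ahead m' s' C')
    show False
    proof (cases "cyc i k k'")
      case True
      moreover have "cyc (real k') s (real i)"
        using cyc_between(1)[OF _ E(4)] ahead(1) by simp
      ultimately show False
        using blocked_beyond[OF idx(1,3,4) _ E(1-3) _ E(5,6)] vis(2) by blast
    next
      case False
      then have "cyc i k' k"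
        using cyc_total cyc_distinct(1) \<open>cyc i k j\<close> ahead(1) \<open>k' \<noteq> k\<close> by metis
      moreover have "cyc (real k) s' (real i)"
        using cyc_between(1)[OF _ ahead(7)] \<open>cyc i k j\<close> by simp
      ultimately show False
        using blocked_beyond[OF idx(1,4,3) _ ahead(4-6) _ ahead(8,9)] vis(1) by blast
    qed
  next
    case (behind m' s' C')
    have kk: "cyc i k k'" "cyc k k' i"
      using cyc_between(1)[OF \<open>cyc i k j\<close> behind(1)] cyc_rotate by blast+
    \<comment> \<open>Exits are interior to edges, so their parameters are not integers.\<close>
    have "s \<noteq> real k'" "s' \<noteq> real k"
      using E(2,3) behind(4,5) by (auto dest!: not_sym)
    then consider "cyc (real k') s (real i)" | "cyc (real i) s' (real k)"
      | "cyc (real k) s' s" "cyc s (real k') (real k)"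
      using cyc_two_chords[of "real i" "real k" "real j" "real k'" s s']
        E(4) behind(1,6) \<open>cyc i k j\<close> by auto
    then show False
    proof cases
      case 1
      then show False using blocked_beyond[OF idx(1,3,4) kk(1) E(1-3) _ E(5,6)] vis(2) by blast
    next
      case 2
      then show False
        using blocked_behind[OF idx(1,4,3) kk(2) behind(3-5) _ behind(7,8)] vis(1) by blast
    next
      case 3
      have "C \<inter> C' \<noteq> {}"
        using interlaced_polygon_chords_meet[OF E(6) _ 3, of C'] behind(8) chord_commute
          E(1-3) behind(3-5) idx by auto
      moreover have ne: "i \<noteq> k" using \<open>cyc i k j\<close> by (auto simp: cyc_def)
      have "C \<subseteq> line p \<L> i k" "p i \<notin> C"
        using E(5) ray_facts(1,2)[OF idx(1,3) ne] by blast+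
      moreover have "C' \<subseteq> line p \<L> i k'"
        using behind(7) ray_facts(1)[OF idx(1,4)] idx(6) by auto
      moreover have "line p \<L> i k \<inter> line p \<L> i k' = {p i}"
        using lines_through_vertex[OF idx(1,3,4) ne] idx(6) \<open>k' \<noteq> k\<close> by auto
      ultimately have "C \<inter> C' \<subseteq> {p i}" using Int_mono by metis
      then show False using \<open>C \<inter> C' \<noteq> {}\<close> \<open>p i \<notin> C\<close> by auto
    qed
  qed
qed

text \<open>Since \<open>t\<close> comes no later than \<open>j\<close> after \<open>k\<close>, the
  walk from \<open>t\<close> to \<open>i\<close> contains the walk from \<open>j\<close> to
  \<open>i\<close>; the same ray and exit edge therefore witness the blocker for
  \<open>t\<close>.\<close>

lemma designated_blocker_beyond:
  assumes k: "designated_blocker n p \<L> i j k" and "cyc i k j"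
    and t: "t < n" "t = j \<or> cyc k t j"
  shows "invisible_pair n p \<L> i t" "designated_blocker n p \<L> i t k"
proof -
  have idx: "i < n" "j < n" "k < n" "i \<noteq> j" and vis: "sees n p \<L> i k"
    using k unfolding designated_blocker_def invisible_pair_def by auto
  have ktj: "t = j \<or> cyc t j i"
    using cyc_trans(2) cyc_rotate[OF \<open>cyc i k j\<close>] t(2) by blast
  have cyc: "cyc i k t"
    using cyc_trans(1) cyc_rotate \<open>cyc i k j\<close> t(2) by metis
  then have ne: "i \<noteq> t" "k \<noteq> i" "k \<noteq> t" using cyc_distinct by metis+
  have nocyc: "\<not> cyc j k i" using \<open>cyc i k j\<close> by (auto simp: cyc_def)
  obtain m s C where E: "m \<in> walk_edges n j i"
    "first_exits_through (ray p \<L> k i) (p k) (- outside (boundary n p \<L>)) (edge n p \<L> m)"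
    "m < n" "real m < s" "s < real (Suc m)" "cyc (real j) s (real i)"
    "C \<subseteq> ray p \<L> k i" "chord g (real k / real n) (s / real n) C"
    using k nocyc by (cases rule: designated_blockerE) auto
  have "cyc (real t) s (real i)"
    using E(6) ktj cyc_between(1)[OF _ E(6), of "real t"] cyc_rotate cyc_of_nat by metis
  then have "\<not> sees n p \<L> i t"
    using blocked_beyond[of i k t m s C] E idx t cyc by auto
  then show inv: "invisible_pair n p \<L> i t"
    unfolding invisible_pair_def using idx t ne by auto
  have "m \<in> walk_edges n t i"
  proof -
    have "m = j \<or> cyc j m i" using E(1) mem_walk_edges[OF idx(2,1)] by blast
    then have "m = t \<or> cyc t m i" using ktj cyc_between(1) cyc_rotate by metis
    then show ?thesis using mem_walk_edges[OF t(1) idx(1)] E(3) ne by blast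
  qed
  moreover have "k \<in> walk_vertices n i t" using mem_walk_vertices idx t cyc by blast
  ultimately show "designated_blocker n p \<L> i t k"
    unfolding designated_blocker_def using inv E(2) vis idx(3) ne(2,3) by blast
qed

text \<open>The two rays are the opposite ends of one line and hence disjoint. Mutual blocking would
  put the exits in the order \<open>k\<close>, \<open>s'\<close>, \<open>s\<close>,
  \<open>i\<close>, forcing the exit chords to meet.\<close>

lemma designated_blocker_not_mutual:
  assumes k: "designated_blocker n p \<L> i j k" and "cyc i k j"
  shows "\<not> designated_blocker n p \<L> k j i"
proof
  assume i: "designated_blocker n p \<L> k j i"
  have idx: "i < n" "j < n" "k < n" "i \<noteq> k"
    using k unfolding designated_blocker_def invisible_pair_def by auto
  have nocyc: "\<not> cyc j k i" "\<not> cyc k i j" using \<open>cyc i k j\<close> by (auto simp: cyc_def)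
  obtain m s C where E: "m < n" "real m < s" "s < real (Suc m)" "cyc (real j) s (real i)"
    "C \<subseteq> ray p \<L> k i" "chord g (real k / real n) (s / real n) C"
    using k nocyc by (cases rule: designated_blockerE) auto
  obtain m' s' C' where E': "m' < n" "real m' < s'" "s' < real (Suc m')" "cyc (real k) s' (real j)"
    "C' \<subseteq> ray p \<L> i k" "chord g (real i / real n) (s' / real n) C'"
    using i nocyc by (cases rule: designated_blockerE) auto
  have "cyc (real k) s' s" "cyc s (real i) (real k)"
  proof -
    have ikj: "cyc (real i) (real k) (real j)" using \<open>cyc i k j\<close> by simp
    show "cyc (real k) s' s"
      using cyc_trans(1)[OF E'(4) cyc_between(2)[OF ikj E(4)]] .
    show "cyc s (real i) (real k)"
      using cyc_rotate[OF cyc_between(1)[OF ikj E(4)]] .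
  qed
  then have "C \<inter> C' \<noteq> {}"
    using interlaced_polygon_chords_meet[OF E(6), of s' "real i" C'] E'(6) chord_commute
      E(1-3) E'(1-3) idx by auto
  then show False using E(5) E'(5) ray_facts(3)[of i k] idx by blast
qed

end

text \<open>That a blocker is assigned to a pair is expressed by invisibility together with being
  the only designated blocker, so uniqueness is proved along with the blocking property.\<close>

theorem mainTheorem3:
  fixes n :: nat and p :: "nat \<Rightarrow> complex" and \<L> :: "complex set set" and i j k :: nat
  assumes "pseudo_polygon n p \<L>"
    and "designated_blocker n p \<L> i j k"
    and "k \<in> walk_vertices n i j"
  shows "(\<forall>t \<in> walk_vertices n (Suc k mod n) j.
            invisible_pair n p \<L> i t \<and>
            (\<forall>k'. designated_blocker n p \<L> i t k' \<longleftrightarrow> k' = k)) \<and>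
         (invisible_pair n p \<L> k j \<longrightarrow> \<not> designated_blocker n p \<L> k j i)"
proof -
  obtain g where g: "simple_path g" "pathfinish g = pathstart g"
    "\<forall>i<n. g (real i / real n) = p i \<and>
       g ` {real i / real n .. real (Suc i) / real n} = edge n p \<L> i"
    using assms(1) unfolding pseudo_polygon_def counterclockwise_def by (elim conjE exE) blast
  have "pseudo_configuration n p \<L>" using assms(1) unfolding pseudo_polygon_def by blast
  then interpret pseudo_polygon_walk n p \<L> g
    using g by (simp add: pseudo_polygon_walk_def)
  have idx: "i < n" "j < n" "k < n" "k \<noteq> i" "k \<noteq> j"
    using assms(2) unfolding designated_blocker_def invisible_pair_def by auto
  have cyc: "cyc i k j" using assms(3) mem_walk_vertices[OF idx(1,2)] idx by blast
  have "invisible_pair n p \<L> i t \<and> (\<forall>k'. designated_blocker n p \<L> i t k' \<longleftrightarrow> k' = k)"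
    if "t \<in> walk_vertices n (Suc k mod n) j" for t
  proof -
    have t: "t < n" "t = j \<or> cyc k t j"
      using walk_vertices_Suc_mod[OF idx(3,2,5) that] by auto
    have "cyc i k t"
      using cyc_trans(1) cyc_rotate cyc t(2) by metis
    moreover note designated_blocker_beyond[OF assms(2) cyc t]
    ultimately show ?thesis using designated_blocker_unique by blast
  qed
  then show ?thesis using designated_blocker_not_mutual[OF assms(2) cyc] by blast
qed

end
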